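(* For $k\in\mathbb{R}\setminus\{0\}$ let $\varrho_k(x)=\exp(-2\pi i kx)$ on $[0,1]$. Then: (a) for each fixed $n\in\mathbb{N}$, $$\lim_{|k|\to\infty}e(n,I_{\varrho_k},H^1)\cdot|k|=\frac{1}{2\pi};$$ (b) for each fixed $k\in\mathbb{R}\setminus\{0\}$, $$\lim_{n\to\infty}e(n,I_{\varrho_k},H^1)\cdot n=\frac{1}{2\sqrt3}.$$ (c) The asymptotic constants $1/(2\pi)$ and $1/(2\sqrt3)$ are the same for both spaces $H^1_0$ and $H^1$; that is, $\lim_{|k|\to\infty}e(n,I_{\varrho_k},H^1_0)\cdot|k|=\frac{1}{2\pi}$ for each fixed $n\in\mathbb{N}$, and $\lim_{n\to\infty}e(n,I_{\varrho_k},H^1_0)\cdot n=\frac{1}{2\sqrt3}$ for each fixed $k\in\mathbb{R}\setminus\{0\}$.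
   Context: $H^1=H^1([0,1])$ is the space of all absolutely continuous $f:[0,1]\to\mathbb{C}$ with $f'\in L_2([0,1])$, equipped with the semi-norm $\|f\|:=\|f'\|_{L_2}$. $H^1_0=H^1_0([0,1])$ is the subspace of those $f\in H^1$ with $f(0)=f(1)=0$, on which $\|f\|=\|f'\|_{L_2}$ is a norm. Set $I_{\varrho_k}(f)=\int_0^1 f(x)\varrho_k(x)\,dx$. For $F\in\{H^1_0,H^1\}$, the $n$th minimal worst case error is $e(n,I_{\varrho_k},F)=\inf_{A_n}\sup_{f\in F,\,\|f\|\le1}|I_{\varrho_k}(f)-A_n(f)|$, where the infimum is over all algorithms $A_n(f)=\phi(f(x_1),\dots,f(x_n))$ using at most $n$ function values (arbitrary nodes in $[0,1]$ and arbitrary $\phi:\mathbb{C}^n\to\mathbb{C}$); thus it is the error for optimal nodes.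
   Formalization: Part (a) is proved for n ≥ 2 only; for n = 1 it is false, since e(1, I_{ρ_k}, H^1)·|k| tends to √2/(2π), and for n = 0 the error is infinite for non-integer k. *)

theory Defs
  imports "HOL-Analysis.Analysis"
begin

definition abs_continuous_on :: "real set \<Rightarrow> (real \<Rightarrow> complex) \<Rightarrow> bool" where
  "abs_continuous_on S f \<longleftrightarrow>
     (\<forall>\<epsilon>>0. \<exists>\<delta>>0. \<forall>(m::nat) (a::nat \<Rightarrow> real) b.
        (\<forall>i<m. a i \<le> b i \<and> {a i..b i} \<subseteq> S) \<longrightarrow>
        disjoint_family_on (\<lambda>i. {a i<..<b i}) {..<m} \<longrightarrow>
        (\<Sum>i<m. b i - a i) < \<delta> \<longrightarrow>
        (\<Sum>i<m. norm (f (b i) - f (a i))) < \<epsilon>)"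

text \<open>Functions on the unit interval are total functions of which only the values on the
  interval matter. \<open>deriv01 f x\<close> is an unspecified value where \<open>f\<close> is not differentiable; for
  \<open>f\<close> in \<open>H1\<close> this is a null set.\<close>

definition deriv01 :: "(real \<Rightarrow> complex) \<Rightarrow> real \<Rightarrow> complex" where
  "deriv01 f x = vector_derivative f (at x within {0..1})"

definition square_integrable01 :: "(real \<Rightarrow> complex) \<Rightarrow> bool" where
  "square_integrable01 g \<longleftrightarrow>
     g \<in> borel_measurable (lebesgue_on {0..1}) \<and>
     integrable (lebesgue_on {0..1}) (\<lambda>x. (norm (g x))\<^sup>2)"

text \<open>The almost-everywhere differentiability clause follows from absolute continuity by
  Lebesgue's theorem; it is spelled out because \<^const>\<open>vector_derivative\<close> is total.\<close>

definition H1 :: "(real \<Rightarrow> complex) set" where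
  "H1 = {f. abs_continuous_on {0..1} f \<and>
            (AE x in lebesgue_on {0..1}. f differentiable (at x within {0..1})) \<and>
            square_integrable01 (deriv01 f)}"

definition H1_0 :: "(real \<Rightarrow> complex) set" where
  "H1_0 = {f \<in> H1. f 0 = 0 \<and> f 1 = 0}"

definition H1_seminorm :: "(real \<Rightarrow> complex) \<Rightarrow> real" where
  "H1_seminorm f = sqrt (LINT x|lebesgue_on {0..1}. (norm (deriv01 f x))\<^sup>2)"

definition rho :: "real \<Rightarrow> real \<Rightarrow> complex" where
  "rho k x = exp (- 2 * of_real pi * \<i> * of_real k * of_real x)"

definition I_rho :: "real \<Rightarrow> (real \<Rightarrow> complex) \<Rightarrow> complex" where
  "I_rho k f = (LINT x|lebesgue_on {0..1}. f x * rho k x)"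

definition algorithms :: "nat \<Rightarrow> ((real \<Rightarrow> complex) \<Rightarrow> complex) set" where
  "algorithms n = {A. \<exists>(xs :: real list) (\<phi> :: complex list \<Rightarrow> complex).
      length xs \<le> n \<and> set xs \<subseteq> {0..1} \<and> A = (\<lambda>f. \<phi> (map f xs))}"

text \<open>The worst case error of an arbitrary (possibly discontinuous) \<open>\<phi>\<close> may be infinite, hence
  the extended nonnegative reals.\<close>

definition minimal_error ::
  "nat \<Rightarrow> ((real \<Rightarrow> complex) \<Rightarrow> complex) \<Rightarrow> (real \<Rightarrow> complex) set \<Rightarrow> ennreal" where
  "minimal_error n J F =
     (INF A\<in>algorithms n. SUP f\<in>{f \<in> F. H1_seminorm f \<le> 1}. ennreal (norm (J f - A f)))"

end

theory Submission
  imports Defs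
begin

text \<open>Let \<open>w = 2 \<pi> k\<close> and let \<open>\<Phi>\<close> be a primitive of \<open>\<rho>\<^sub>k\<close>, with \<open>c\<^sub>j\<close> its mean over the \<open>j\<close>-th cell between consecutive
  nodes. Once the values at the nodes (with both end points among them) are known, integration by parts leaves
  \<open>- \<Sum>\<^sub>j \<integral> f' (\<Phi> - c\<^sub>j)\<close>, so by Cauchy--Schwarz the squared error is the sum over the cells of
  \<open>\<integral> \<bar>\<Phi> - c\<^sub>j\<bar>\<^sup>2\<close>. This is attained by the function with derivative proportional to the conjugate of
  \<open>\<Phi> - c\<^sub>j\<close>, which vanishes at all nodes. On a cell of length \<open>L\<close> the contribution is
  \<open>(L - (2 - 2 cos w L) / (w\<^sup>2 L)) / w\<^sup>2\<close>. It behaves like \<open>L / w\<^sup>2\<close> for large \<open>w\<close> and like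
  \<open>L\<^sup>3 / 12\<close> for small \<open>L\<close>, and \<open>\<Sum>\<^sub>j L\<^sub>j\<^sup>3\<close> is least for equal cells.\<close>

subsection \<open>The fundamental theorem of calculus for absolutely continuous functions\<close>

text \<open>The pieces of a tagged partial division have disjoint interiors, which is exactly the
  kind of interval family that absolute continuity controls. In this form it applies directly to
  Riemann sums over gauge-fine divisions.\<close>

lemma abs_continuous_on_tagged_sum:
  assumes ac: "abs_continuous_on {a..b} f" and "\<epsilon> > 0"
  obtains \<delta> where "\<delta> > 0"
    "\<And>q. \<lbrakk>q tagged_partial_division_of {a..b}; (\<Sum>(x,K)\<in>q. measure lborel K) < \<delta>\<rbrakk>
       \<Longrightarrow> (\<Sum>(x,K)\<in>q. norm (f (Sup K) - f (Inf K))) < \<epsilon>"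
proof -
  obtain \<delta> where "\<delta> > 0" and \<delta>: "\<And>(m::nat) a' b'.
        (\<forall>i<m. a' i \<le> b' i \<and> {a' i..b' i} \<subseteq> {a..b}) \<Longrightarrow>
        disjoint_family_on (\<lambda>i. {a' i<..<b' i}) {..<m} \<Longrightarrow>
        (\<Sum>i<m. b' i - a' i) < \<delta> \<Longrightarrow>
        (\<Sum>i<m. norm (f (b' i) - f (a' i))) < \<epsilon>"
    using ac \<open>\<epsilon> > 0\<close> unfolding abs_continuous_on_def by meson
  show thesis
  proof (rule that[OF \<open>\<delta> > 0\<close>])
    fix q assume q: "q tagged_partial_division_of {a..b}" and small: "(\<Sum>(x,K)\<in>q. measure lborel K) < \<delta>"
    note qD = tagged_partial_division_ofD[OF q]
    obtain h where h: "bij_betw h {..<card q} q"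
      using ex_bij_betw_nat_finite[OF qD(1)] by (auto simp: atLeast0LessThan)
    define A where "A i = Inf (snd (h i))" for i
    define B where "B i = Sup (snd (h i))" for i
    have hq: "h i \<in> q" if "i < card q" for i
      using h that by (auto simp: bij_betw_def)
    have AB: "A i \<le> B i \<and> snd (h i) = {A i..B i} \<and> snd (h i) \<subseteq> {a..b}" if "i < card q" for i
    proof -
      have mem: "(fst (h i), snd (h i)) \<in> q" using hq[OF that] by simp
      obtain u v where uv: "snd (h i) = cbox u v" using qD(4)[OF mem] by blast
      moreover have "u \<le> v" using qD(2)[OF mem] uv by auto
      ultimately show ?thesis using qD(3)[OF mem] by (auto simp: A_def B_def)
    qed
    have sum_eq: "(\<Sum>i<card q. F (snd (h i))) = (\<Sum>(x,K)\<in>q. F K)" for F :: "real set \<Rightarrow> real"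
      using sum.reindex_bij_betw[OF h, of "\<lambda>(x,K). F K"] by (simp add: case_prod_unfold)
    have "(\<Sum>i<card q. norm (f (B i) - f (A i))) < \<epsilon>"
    proof (rule \<delta>)
      show "\<forall>i<card q. A i \<le> B i \<and> {A i..B i} \<subseteq> {a..b}" 
      proof (intro allI impI)
        fix i assume "i < card q"
        from AB[OF this] show "A i \<le> B i \<and> {A i..B i} \<subseteq> {a..b}" by metis
      qed
      show "disjoint_family_on (\<lambda>i. {A i<..<B i}) {..<card q}"
        unfolding disjoint_family_on_def
      proof clarify
        fix i j assume ij: "i < card q" "j < card q" "i \<noteq> j"
        then have "h i \<noteq> h j" using h by (auto simp: bij_betw_def inj_on_def)
        then have "interior (snd (h i)) \<inter> interior (snd (h j)) = {}"
          using qD(5)[of "fst (h i)" "snd (h i)" "fst (h j)" "snd (h j)"] hq ij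
          by (simp add: prod_eq_iff)
        then show "{A i<..<B i} \<inter> {A j<..<B j} = {}"
          using AB[OF ij(1)] AB[OF ij(2)] by simp
      qed
      have "(\<Sum>i<card q. B i - A i) = (\<Sum>i<card q. measure lborel (snd (h i)))"
      proof (rule sum.cong[OF refl])
        fix i assume "i \<in> {..<card q}"
        then show "B i - A i = measure lborel (snd (h i))" using AB[of i] by simp
      qed
      then show "(\<Sum>i<card q. B i - A i) < \<delta>" using small sum_eq[of "measure lborel"] by simp
    qed
    then show "(\<Sum>(x,K)\<in>q. norm (f (Sup K) - f (Inf K))) < \<epsilon>"
      using sum_eq[of "\<lambda>K. norm (f (Sup K) - f (Inf K))"] by (simp add: A_def B_def)
  qed
qed

text \<open>Riemann sums are compared with the increments of \<open>f\<close> on two families of intervals: those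
  tagged outside the exceptional set by differentiability, those tagged inside it by absolute
  continuity, as the gauge keeps them in an open set of small measure.\<close>

theorem fundamental_theorem_of_calculus_abs_continuous:
  fixes f :: "real \<Rightarrow> complex"
  assumes "a \<le> b" and ac: "abs_continuous_on {a..b} f" and S: "negligible S"
    and vecd: "\<And>x. x \<in> {a..b} - S \<Longrightarrow> (f has_vector_derivative g x) (at x within {a..b})"
  shows "(g has_integral (f b - f a)) {a..b}"
proof -
  \<comment> \<open>Setting the integrand to zero on \<open>S\<close> leaves only the increments of
    \<open>f\<close> in the terms tagged there.\<close>
  define f' where "f' x = (if x \<in> S then 0 else g x)" for x
  have "(f' has_integral (f b - f a)) {a..b}"
    unfolding has_integral_real
  proof (intro allI impI)
    fix \<epsilon> :: real assume "\<epsilon> > 0"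
    \<comment> \<open>The \<open>+ 1\<close> keeps the denominator positive when
      \<open>a = b\<close>.\<close>
    define e where "e = \<epsilon> / (2 * (b - a + 1))"
    have "e > 0" and eb: "e * (b - a) \<le> \<epsilon> / 2"
      using \<open>\<epsilon> > 0\<close> \<open>a \<le> b\<close> by (auto simp: e_def divide_simps)
    obtain \<delta> where "\<delta> > 0" and \<delta>: "\<And>q. \<lbrakk>q tagged_partial_division_of {a..b}; (\<Sum>(x,K)\<in>q. measure lborel K) < \<delta>\<rbrakk>
       \<Longrightarrow> (\<Sum>(x,K)\<in>q. norm (f (Sup K) - f (Inf K))) < \<epsilon>/2"
      by (rule abs_continuous_on_tagged_sum[OF ac half_gt_zero[OF \<open>\<epsilon> > 0\<close>]]) blast
    have "S \<in> sets lebesgue" using S by (simp add: negligible_iff_null_sets null_setsD2)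
    \<comment> \<open>Outer regularity bounds only \<open>T - S\<close>; as \<open>S\<close> is
      null, \<open>T\<close> itself has measure below \<delta>.\<close>
    then obtain T where T: "open T" "S \<subseteq> T" "T - S \<in> lmeasurable" "emeasure lebesgue (T - S) < ennreal \<delta>"
      using sets_lebesgue_outer_open[OF _ \<open>\<delta> > 0\<close>] by metis
    have nS: "S \<in> null_sets lebesgue" using S by (simp add: negligible_iff_null_sets)
    have TL: "T \<in> lmeasurable"
      using T nS by (metis borel_open measurable_Diff_null_set sets_completionI_sets sets_lborel)
    have mT: "measure lebesgue T < \<delta>"
      using T(4)
      using emeasure_eq_measure2[OF T(3)] measure_Diff_null_set[OF fmeasurableD[OF TL] nS]
      by (simp add: ennreal_less_iff)
    \<comment> \<open>The radius of the gauge: inside \<open>T\<close> at exceptional points, small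
      enough for the derivative estimate at the other points of the interval, arbitrary
      elsewhere.\<close>
    have "\<exists>d>0. (x \<in> S \<longrightarrow> ball x d \<subseteq> T) \<and> (x \<in> {a..b} - S \<longrightarrow>
         (\<forall>y\<in>{a..b}. norm (y-x) < d \<longrightarrow> norm (f y - f x - (y-x) *\<^sub>R f' x) \<le> e * norm (y-x)))" for x
    proof (cases "x \<in> S")
      case True
      then show ?thesis using T by (meson DiffD2 open_contains_ball subsetD)
    next
      case False
      show ?thesis
      proof (cases "x \<in> {a..b}")
        case True
        then show ?thesis
          using vecd[of x] False \<open>e > 0\<close>
          unfolding has_vector_derivative_def has_derivative_within_alt f'_def
          by (auto simp only: Diff_iff if_False simp_thms)
      next
        case F: False
        with False show ?thesis by (intro exI[of _ 1]) auto
      qed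
    qed
    then obtain d where d0: "\<And>x. 0 < d x" and dT: "\<And>x. x \<in> S \<Longrightarrow> ball x (d x) \<subseteq> T"
      and d: "\<And>x y. \<lbrakk>x \<in> {a..b} - S; y \<in> {a..b}; norm (y-x) < d x\<rbrakk>
                          \<Longrightarrow> norm (f y - f x - (y-x) *\<^sub>R f' x) \<le> e * norm (y-x)"
      by metis
    show "\<exists>\<gamma>. gauge \<gamma> \<and> (\<forall>p. p tagged_division_of {a..b} \<and> \<gamma> fine p \<longrightarrow>
        norm ((\<Sum>(x, k)\<in>p. measure lborel k *\<^sub>R f' x) - (f b - f a)) < \<epsilon>)"
    proof (rule exI, safe)
      show "gauge (\<lambda>x. ball x (d x))" using d0 gauge_ball_dependent by blast
    next
      fix p assume ptag: "p tagged_division_of {a..b}" and finep: "(\<lambda>x. ball x (d x)) fine p"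
      note pD = tagged_division_ofD[OF ptag]
      define q where "q = {xK \<in> p. fst xK \<in> S}"
      have qp: "q \<subseteq> p" by (auto simp: q_def)
      have qt: "q tagged_partial_division_of {a..b}"
        using tagged_partial_division_subset[OF _ qp] ptag by (auto simp: tagged_division_of_def)
      \<comment> \<open>Two tags can share an interval only if it is degenerate, so summing over
        intervals instead of tagged pairs changes nothing.\<close>
      have "(\<Sum>(x,K)\<in>q. measure lborel K) = (\<Sum>K\<in>snd ` q. measure lborel K)"
        by (rule sum.over_tagged_division_lemma[OF tagged_partial_division_of_Union_self[OF qt]])
           (simp add: content_eq_0_interior)
      also have "\<dots> = measure lebesgue (\<Union>(snd ` q))"
        unfolding content_division[OF partial_division_of_tagged_division[OF qt], symmetric]
        using division_ofD(4)[OF partial_division_of_tagged_division[OF qt]]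
        by (intro sum.cong) fastforce+
      also have "\<dots> \<le> measure lebesgue T"
      proof (rule measure_mono_fmeasurable[OF _ _ TL])
        show "\<Union>(snd ` q) \<subseteq> T"
          using finep dT qp by (fastforce simp: q_def fine_def)
        show "\<Union>(snd ` q) \<in> sets lebesgue"
          using lmeasurable_division[OF partial_division_of_tagged_division[OF qt]] by (rule fmeasurableD)
      qed
      also have "\<dots> < \<delta>" by (rule mT)
      finally have q_small: "(\<Sum>(x,K)\<in>q. norm (f (Sup K) - f (Inf K))) < \<epsilon>/2"
        using \<delta>[OF qt] by simp
      define D where "D = (\<lambda>(x,K). measure lborel K *\<^sub>R f' x - (f (Sup K) - f (Inf K)))"
      have "norm (sum D (p - q)) \<le> (\<Sum>n\<in>p - q. e * (case n of (x, k) \<Rightarrow> Sup k - Inf k))"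
      proof (rule sum_norm_le, safe)
        fix x K assume xK: "(x, K) \<in> p" "(x,K) \<notin> q"
        then have "x \<notin> S" by (auto simp: q_def)
        have "x \<in> K" and kab: "K \<subseteq> {a..b}" using pD xK by blast+
        obtain u v where k: "K = {u..v}" using pD(4)[OF xK(1)] by auto
        have "u \<le> v" using \<open>x \<in> K\<close> unfolding k by auto
        have ball: "\<forall>y\<in>K. y \<in> ball x (d x)" using finep \<open>(x, K) \<in> p\<close> by blast
        have "u \<in> K" "v \<in> K" by (simp_all add: \<open>u \<le> v\<close> k)
        \<comment> \<open>Both ends are compared with the tag \<open>x\<close>, which lies between
          them, so the two errors add up to \<open>e * (v - u)\<close>.\<close>
        have "norm ((v - u) *\<^sub>R f' x - (f v - f u)) = norm (f u - f x - (u - x) *\<^sub>R f' x - (f v - f x - (v - x) *\<^sub>R f' x))"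
          by (auto simp: algebra_simps)
        also have "\<dots> \<le> norm (f u - f x - (u - x) *\<^sub>R f' x) + norm (f v - f x - (v - x) *\<^sub>R f' x)"
          by (rule norm_triangle_ineq4)
        also have "\<dots> \<le> e * norm (u - x) + e * norm (v - x)"
          using \<open>x \<in> K\<close> \<open>x \<notin> S\<close> \<open>u \<in> K\<close> \<open>v \<in> K\<close> kab ball
          by (intro add_mono d) (auto simp: dist_real_def)
        also have "\<dots> \<le> e * (Sup K - Inf K)"
          using \<open>x \<in> K\<close> by (auto simp: k field_simps)
        finally show "norm (D (x,K)) \<le> e * (Sup K - Inf K)"
          using \<open>u \<le> v\<close> by (simp add: k D_def)
      qed
      also have "\<dots> \<le> (\<Sum>n\<in>p. e * (case n of (x, k) \<Rightarrow> Sup k - Inf k))"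
      proof (rule sum_mono2)
        fix n assume "n \<in> p - (p - q)"
        moreover obtain x K where "n = (x, K)" by (cases n)
        ultimately have "n = (x,K)" "(x,K) \<in> p" by auto
        moreover then obtain u v where "K = {u..v}" using pD(4) by (metis box_real(2))
        ultimately have "n = (x, {u..v})" "x \<in> {u..v}" using pD(2)[of x K] by auto
        then show "0 \<le> e * (case n of (x, k) \<Rightarrow> Sup k - Inf k)" using \<open>e > 0\<close> by auto
      qed (use pD in auto)
      also have "\<dots> = e * (b - a)"
        using additive_tagged_division_1[where f= "\<lambda>x. x", OF \<open>a \<le> b\<close> ptag]
        by (simp add: sum_distrib_left[symmetric])
      finally have pq: "norm (sum D (p - q)) \<le> \<epsilon>/2" using eb by simp
      have "norm (sum D q) \<le> (\<Sum>(x,K)\<in>q. norm (f (Sup K) - f (Inf K)))"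
        by (rule sum_norm_le) (auto simp: D_def q_def f'_def norm_minus_commute)
      then have "norm (sum D (p - q) + sum D q) < \<epsilon>"
        using norm_triangle_ineq[of "sum D (p - q)" "sum D q"] pq q_small by linarith
      also have "sum D (p - q) + sum D q = sum D p"
        using sum.subset_diff[OF qp, of D] pD(1) by simp
      also have "sum D p = (\<Sum>(x, k)\<in>p. measure lborel k *\<^sub>R f' x) - (f b - f a)"
        using additive_tagged_division_1[where f=f, OF \<open>a \<le> b\<close> ptag]
        by (simp add: D_def split_def sum_subtractf)
      finally show "norm ((\<Sum>(x, k)\<in>p. measure lborel k *\<^sub>R f' x) - (f b - f a)) < \<epsilon>" .
    qed
  qed
  then show ?thesis
    by (rule has_integral_spike[OF S, rotated]) (auto simp: f'_def)
qed

section \<open>Closure properties of absolute continuity\<close>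

lemma abs_continuous_on_subset:
  assumes "abs_continuous_on S f" "T \<subseteq> S"
  shows "abs_continuous_on T f"
  using assms unfolding abs_continuous_on_def by (meson order_trans)

lemma abs_continuous_on_imp_continuous_on:
  assumes "abs_continuous_on {a..b} f"
  shows "continuous_on {a..b} f"
  unfolding continuous_on_iff
proof (intro ballI allI impI)
  fix x \<epsilon> :: real assume x: "x \<in> {a..b}" and "\<epsilon> > 0"
  then obtain \<delta> where "\<delta> > 0" and \<delta>: "\<And>(m::nat) a' b'.
        (\<forall>i<m. a' i \<le> b' i \<and> {a' i..b' i} \<subseteq> {a..b}) \<Longrightarrow>
        disjoint_family_on (\<lambda>i. {a' i<..<b' i}) {..<m} \<Longrightarrow>
        (\<Sum>i<m. b' i - a' i) < \<delta> \<Longrightarrow>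
        (\<Sum>i<m. norm (f (b' i) - f (a' i))) < \<epsilon>"
    using assms unfolding abs_continuous_on_def by meson
  show "\<exists>d>0. \<forall>y\<in>{a..b}. dist y x < d \<longrightarrow> dist (f y) (f x) < \<epsilon>"
  proof (intro exI conjI ballI impI)
    fix y assume y: "y \<in> {a..b}" "dist y x < \<delta>"
    have "norm (f (max x y) - f (min x y)) < \<epsilon>"
      using \<delta>[of "1" "\<lambda>_. min x y" "\<lambda>_. max x y"] x y
      by (auto simp: disjoint_family_on_def dist_real_def max_def min_def split: if_splits)
    then show "dist (f y) (f x) < \<epsilon>"
      by (auto simp: max_def min_def dist_norm norm_minus_commute split: if_splits)
  qed (rule \<open>\<delta> > 0\<close>)
qed

lemma abs_continuous_on_lipschitz:
  assumes "C > 0" and lip: "\<And>x y. \<lbrakk>x \<in> S; y \<in> S; x \<le> y\<rbrakk> \<Longrightarrow> norm (f y - f x) \<le> C * (y - x)"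
  shows "abs_continuous_on S f"
  unfolding abs_continuous_on_def
proof (intro allI impI)
  fix \<epsilon> :: real assume "\<epsilon> > 0"
  show "\<exists>\<delta>>0. \<forall>(m::nat) (a::nat \<Rightarrow> real) b.
        (\<forall>i<m. a i \<le> b i \<and> {a i..b i} \<subseteq> S) \<longrightarrow>
        disjoint_family_on (\<lambda>i. {a i<..<b i}) {..<m} \<longrightarrow>
        (\<Sum>i<m. b i - a i) < \<delta> \<longrightarrow> (\<Sum>i<m. norm (f (b i) - f (a i))) < \<epsilon>"
  proof (intro exI[of _ "\<epsilon> / C"] conjI allI impI)
    fix m :: nat and a b :: "nat \<Rightarrow> real"
    assume ab: "\<forall>i<m. a i \<le> b i \<and> {a i..b i} \<subseteq> S" and small: "(\<Sum>i<m. b i - a i) < \<epsilon> / C"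
    have "(\<Sum>i<m. norm (f (b i) - f (a i))) \<le> (\<Sum>i<m. C * (b i - a i))"
      using ab by (intro sum_mono lip) (auto simp: subset_iff)
    also have "\<dots> < \<epsilon>"
      using small \<open>C > 0\<close> by (simp only: sum_distrib_left[symmetric] pos_less_divide_eq mult.commute)
    finally show "(\<Sum>i<m. norm (f (b i) - f (a i))) < \<epsilon>" .
  qed (use \<open>\<epsilon> > 0\<close> \<open>C > 0\<close> in auto)
qed

text \<open>Both factors are bounded by a common \<open>M\<close> on the compact interval, and an
  increment of the product is \<open>g\<close> times an increment of \<open>f\<close> plus
  \<open>f\<close> times an increment of \<open>g\<close>. Hence \<epsilon> / (2M) for each factor
  suffices.\<close>

lemma abs_continuous_on_mult:
  assumes f: "abs_continuous_on {a..b} f" and g: "abs_continuous_on {a..b} g"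
  shows "abs_continuous_on {a..b} (\<lambda>x. f x * g x)"
  unfolding abs_continuous_on_def
proof (intro allI impI)
  fix \<epsilon> :: real assume "\<epsilon> > 0"
  have "bounded (f ` {a..b} \<union> g ` {a..b})"
    using f g by (auto intro!: compact_imp_bounded compact_continuous_image abs_continuous_on_imp_continuous_on)
  then obtain M where "M > 0" and "\<forall>z\<in>f ` {a..b} \<union> g ` {a..b}. norm z \<le> M"
    unfolding bounded_pos by blast
  then have M: "norm (f x) \<le> M" "norm (g x) \<le> M" if "x \<in> {a..b}" for x
    using that by blast+
  have e': "\<epsilon> / (2 * M) > 0" using \<open>\<epsilon> > 0\<close> \<open>M > 0\<close> by simp
  have ex: "\<exists>\<delta>>0. \<forall>(m::nat) l r.
        (\<forall>i<m. l i \<le> r i \<and> {l i..r i} \<subseteq> {a..b}) \<longrightarrow>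
        disjoint_family_on (\<lambda>i. {l i<..<r i}) {..<m} \<longrightarrow>
        (\<Sum>i<m. r i - l i) < \<delta> \<longrightarrow>
        (\<Sum>i<m. norm (h (r i) - h (l i))) < \<epsilon> / (2 * M)" if "abs_continuous_on {a..b} h" for h :: "real \<Rightarrow> complex"
    using that e' unfolding abs_continuous_on_def by blast
  obtain \<delta>1 where "\<delta>1 > 0" and \<delta>1: "\<And>(m::nat) l r.
        (\<forall>i<m. l i \<le> r i \<and> {l i..r i} \<subseteq> {a..b}) \<Longrightarrow>
        disjoint_family_on (\<lambda>i. {l i<..<r i}) {..<m} \<Longrightarrow>
        (\<Sum>i<m. r i - l i) < \<delta>1 \<Longrightarrow>
        (\<Sum>i<m. norm (f (r i) - f (l i))) < \<epsilon> / (2 * M)"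
    using ex[OF f] by meson
  obtain \<delta>2 where "\<delta>2 > 0" and \<delta>2: "\<And>(m::nat) l r.
        (\<forall>i<m. l i \<le> r i \<and> {l i..r i} \<subseteq> {a..b}) \<Longrightarrow>
        disjoint_family_on (\<lambda>i. {l i<..<r i}) {..<m} \<Longrightarrow>
        (\<Sum>i<m. r i - l i) < \<delta>2 \<Longrightarrow>
        (\<Sum>i<m. norm (g (r i) - g (l i))) < \<epsilon> / (2 * M)"
    using ex[OF g] by meson
  show "\<exists>\<delta>>0. \<forall>(m::nat) (l::nat \<Rightarrow> real) r.
        (\<forall>i<m. l i \<le> r i \<and> {l i..r i} \<subseteq> {a..b}) \<longrightarrow>
        disjoint_family_on (\<lambda>i. {l i<..<r i}) {..<m} \<longrightarrow>
        (\<Sum>i<m. r i - l i) < \<delta> \<longrightarrow>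
        (\<Sum>i<m. norm (f (r i) * g (r i) - f (l i) * g (l i))) < \<epsilon>"
  proof (intro exI[of _ "min \<delta>1 \<delta>2"] conjI allI impI)
    fix m :: nat and l r :: "nat \<Rightarrow> real"
    assume lr: "\<forall>i<m. l i \<le> r i \<and> {l i..r i} \<subseteq> {a..b}"
      and dj: "disjoint_family_on (\<lambda>i. {l i<..<r i}) {..<m}"
      and small: "(\<Sum>i<m. r i - l i) < min \<delta>1 \<delta>2"
    have "(\<Sum>i<m. norm (f (r i) * g (r i) - f (l i) * g (l i)))
      \<le> (\<Sum>i<m. M * norm (f (r i) - f (l i)) + M * norm (g (r i) - g (l i)))"
    proof (rule sum_mono)
      fix i assume "i \<in> {..<m}"
      then have i: "l i \<in> {a..b}" "r i \<in> {a..b}" using lr by (auto simp: subset_iff)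
      have "f (r i) * g (r i) - f (l i) * g (l i) = g (r i) * (f (r i) - f (l i)) + f (l i) * (g (r i) - g (l i))"
        by (simp add: algebra_simps)
      then have "norm (f (r i) * g (r i) - f (l i) * g (l i))
          \<le> norm (g (r i)) * norm (f (r i) - f (l i)) + norm (f (l i)) * norm (g (r i) - g (l i))"
        by (metis norm_mult norm_triangle_ineq)
      also have "\<dots> \<le> M * norm (f (r i) - f (l i)) + M * norm (g (r i) - g (l i))"
        using i M by (intro add_mono mult_right_mono) auto
      finally show "norm (f (r i) * g (r i) - f (l i) * g (l i))
          \<le> M * norm (f (r i) - f (l i)) + M * norm (g (r i) - g (l i))" .
    qed
    also have "\<dots> = M * ((\<Sum>i<m. norm (f (r i) - f (l i))) + (\<Sum>i<m. norm (g (r i) - g (l i))))"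
      by (simp add: sum.distrib sum_distrib_left algebra_simps)
    also have "\<dots> < M * (\<epsilon> / (2 * M) + \<epsilon> / (2 * M))"
      using \<delta>1[OF lr dj] \<delta>2[OF lr dj] small \<open>M > 0\<close> by (intro mult_strict_left_mono add_strict_mono) auto
    also have "\<dots> = \<epsilon>" using \<open>M > 0\<close> by (simp add: field_simps)
    finally show "(\<Sum>i<m. norm (f (r i) * g (r i) - f (l i) * g (l i))) < \<epsilon>" .
  qed (use \<open>\<delta>1 > 0\<close> \<open>\<delta>2 > 0\<close> in auto)
qed

text \<open>Converts the almost-everywhere clause of \<open>H1\<close> into the negligible
  exceptional set of the fundamental theorem.\<close>

lemma AE_lebesgue_on_negligible:
  assumes "AE x in lebesgue_on S. P x" "S \<in> sets lebesgue"
  shows "negligible {x \<in> S. \<not> P x}"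
proof -
  have "AE x in lebesgue. x \<in> S \<longrightarrow> P x"
    using assms by (simp add: AE_restrict_space_iff)
  then obtain N where "{x. \<not> (x \<in> S \<longrightarrow> P x)} \<subseteq> N" "N \<in> null_sets lebesgue"
    by (auto elim!: AE_E simp: null_sets_def)
  then show ?thesis
    by (auto simp: negligible_iff_null_sets[symmetric] intro: negligible_subset)
qed

section \<open>The primitive of the oscillating weight\<close>

text \<open>Among all primitives this is the one of constant modulus
  \<open>1 / \<bar>w\<bar>\<close>, where \<open>w = 2 * pi * k\<close>.\<close>

definition rho_primitive :: "real \<Rightarrow> real \<Rightarrow> complex" where
  "rho_primitive k x = \<i> / of_real (2 * pi * k) * rho k x"

lemma rho_eq_cis: "rho k x = cis (- (2 * pi * k * x))"
  by (simp add: rho_def cis_conv_exp mult_ac)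

lemma rho_primitive_has_vector_derivative:
  assumes "k \<noteq> 0"
  shows "(rho_primitive k has_vector_derivative rho k x) (at x within S)"
proof -
  have "((\<lambda>z. \<i> / of_real (2 * pi * k) * exp (- 2 * of_real pi * \<i> * of_real k * z))
      has_field_derivative rho k x) (at (of_real x))"
    unfolding rho_def using assms by (auto intro!: derivative_eq_intros)
  from has_vector_derivative_real_field[OF this]
  have "((\<lambda>x. \<i> / of_real (2 * pi * k) * exp (- 2 * of_real pi * \<i> * of_real k * of_real x))
      has_vector_derivative rho k x) (at x within S)" .
  then show ?thesis
    by (simp add: rho_primitive_def[abs_def] rho_def)
qed

lemma norm_rho [simp]: "norm (rho k x) = 1"
  by (simp add: rho_eq_cis)

lemma continuous_on_rho [continuous_intros]: "continuous_on S (rho k)"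
  unfolding rho_def[abs_def] by (intro continuous_intros)

lemma continuous_on_rho_primitive [continuous_intros]: "continuous_on S (rho_primitive k)"
  unfolding rho_primitive_def[abs_def] by (intro continuous_intros)

lemma norm_rho_primitive: "norm (rho_primitive k x) = 1 / \<bar>2 * pi * k\<bar>"
  by (simp add: rho_primitive_def norm_mult norm_divide abs_mult)

text \<open>Lipschitz with constant 1, because the derivative \<open>rho k\<close> has modulus
  one.\<close>

lemma abs_continuous_on_rho_primitive:
  assumes "k \<noteq> 0"
  shows "abs_continuous_on {a..b} (\<lambda>x. rho_primitive k x - c)"
proof (rule abs_continuous_on_lipschitz[of 1])
  fix x y :: real assume "x \<le> y"
  have "(rho k has_integral rho_primitive k y - rho_primitive k x) {x..y}"
    using \<open>x \<le> y\<close> assms by (intro fundamental_theorem_of_calculus rho_primitive_has_vector_derivative) auto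
  then have "norm (rho_primitive k y - rho_primitive k x) \<le> 1 * measure lborel (cbox x y)"
    by (intro has_integral_bound) auto
  then show "norm (rho_primitive k y - c - (rho_primitive k x - c)) \<le> 1 * (y - x)"
    using \<open>x \<le> y\<close> by simp
qed simp

text \<open>The fundamental theorem for the absolutely continuous product of \<open>f\<close> with a
  shifted primitive. The shift \<open>c\<close> stays free so that each cell can use its own
  mean.\<close>

lemma H1_integration_by_parts:
  assumes f: "f \<in> H1" and "k \<noteq> 0" and ab: "0 \<le> a" "a \<le> b" "b \<le> 1"
  shows "((\<lambda>x. deriv01 f x * (rho_primitive k x - c) + f x * rho k x) has_integral
            f b * (rho_primitive k b - c) - f a * (rho_primitive k a - c)) {a..b}"
proof (rule fundamental_theorem_of_calculus_abs_continuous)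
  show "abs_continuous_on {a..b} (\<lambda>x. f x * (rho_primitive k x - c))"
    using f ab unfolding H1_def
    by (intro abs_continuous_on_mult abs_continuous_on_rho_primitive[OF \<open>k \<noteq> 0\<close>])
       (auto intro: abs_continuous_on_subset)
  show "negligible {x \<in> {0..1}. \<not> f differentiable at x within {0..1}}"
    using f by (intro AE_lebesgue_on_negligible) (auto simp: H1_def)
  fix x assume "x \<in> {a..b} - {x \<in> {0..1}. \<not> f differentiable at x within {0..1}}"
  then have "f differentiable at x within {0..1}" using ab by auto
  then have "(f has_vector_derivative deriv01 f x) (at x within {a..b})"
    unfolding deriv01_def using ab
    by (metis vector_derivative_works has_vector_derivative_within_subset atLeastatMost_subset_iff)
  moreover have "((\<lambda>x. rho_primitive k x - c) has_vector_derivative rho k x) (at x within {a..b})"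
    using has_vector_derivative_diff[OF rho_primitive_has_vector_derivative[OF \<open>k \<noteq> 0\<close>] has_vector_derivative_const]
    by simp
  ultimately show "((\<lambda>x. f x * (rho_primitive k x - c)) has_vector_derivative
      deriv01 f x * (rho_primitive k x - c) + f x * rho k x) (at x within {a..b})"
    using has_vector_derivative_mult by (fastforce simp: add.commute)
qed (use ab in auto)

subsection \<open>Quadrature error on a partition\<close>

text \<open>On a degenerate cell division by zero gives 0, so repeated nodes are harmless.\<close>

definition rho_primitive_mean :: "real \<Rightarrow> real \<Rightarrow> real \<Rightarrow> complex" where
  "rho_primitive_mean k a b = integral {a..b} (rho_primitive k) / of_real (b - a)"

text \<open>For \<open>k \<noteq> 0\<close> this is the squared L2 distance of the primitive from
  the constants on a cell of length \<open>L\<close>. At \<open>L = 0\<close> it evaluates to 0, so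
  coinciding nodes contribute nothing.\<close>

definition cell_defect :: "real \<Rightarrow> real \<Rightarrow> real" where
  "cell_defect k L = (L - (2 - 2 * cos (2 * pi * k * L)) / ((2 * pi * k)\<^sup>2 * L)) / (2 * pi * k)\<^sup>2"

lemma norm_rho_primitive_mean_le: "norm (rho_primitive_mean k a b) \<le> 1 / \<bar>2 * pi * k\<bar>"
proof (cases "a < b")
  case True
  have "norm (integral {a..b} (rho_primitive k)) \<le> 1 / \<bar>2 * pi * k\<bar> * (b - a)"
    using True by (intro integral_bound continuous_intros) (auto simp: norm_rho_primitive)
  then have "norm (integral {a..b} (rho_primitive k)) / (b - a) \<le> 1 / \<bar>2 * pi * k\<bar>"
    using True by (simp only: pos_divide_le_eq diff_gt_0_iff_gt)
  then show ?thesis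
    using True unfolding rho_primitive_mean_def norm_divide norm_of_real by simp
next
  case False
  then have "integral {a..b} (rho_primitive k) = 0" by (cases "a = b") auto
  then show ?thesis by (simp add: rho_primitive_mean_def)
qed

text \<open>The squared chord between two points of the unit circle; it is the source of the cosine
  in \<open>cell_defect\<close>.\<close>

lemma norm_rho_diff_square: "(norm (rho k b - rho k a))\<^sup>2 = 2 - 2 * cos (2 * pi * k * (b - a))"
proof -
  define x where "x = 2 * pi * k * a"
  define y where "y = 2 * pi * k * b"
  have "(norm (rho k b - rho k a))\<^sup>2 = (cos y - cos x)\<^sup>2 + (sin x - sin y)\<^sup>2"
    by (simp add: rho_eq_cis cmod_power2 x_def y_def)
  also have "\<dots> = ((cos x)\<^sup>2 + (sin x)\<^sup>2) + ((cos y)\<^sup>2 + (sin y)\<^sup>2) - 2 * (cos y * cos x + sin y * sin x)"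
    by (simp add: power2_diff algebra_simps)
  also have "\<dots> = 2 - 2 * cos (y - x)"
    by (simp add: cos_diff)
  finally show ?thesis by (simp add: x_def y_def right_diff_distrib)
qed

text \<open>The primitive is a multiple of \<open>rho k\<close>, so integrating it repeats the same
  factor.\<close>

lemma rho_primitive_has_integral:
  assumes "k \<noteq> 0" "a \<le> b"
  shows "(rho_primitive k has_integral \<i> / of_real (2 * pi * k) * (rho_primitive k b - rho_primitive k a)) {a..b}"
proof -
  have "(rho k has_integral rho_primitive k b - rho_primitive k a) {a..b}"
    using assms by (intro fundamental_theorem_of_calculus rho_primitive_has_vector_derivative) auto
  from has_integral_mult_right[OF this, of "\<i> / of_real (2 * pi * k)"] show ?thesis
    by (simp add: rho_primitive_def[abs_def])
qed

text \<open>Variance is the integral of the square minus the part due to the mean: with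
  \<open>J\<close> the integral of the primitive, whose modulus is constantly
  \<open>1 / \<bar>w\<bar>\<close>, it equals
  \<open>L / w\<^sup>2 - (norm J)\<^sup>2 / L\<close>.\<close>

lemma
  assumes "k \<noteq> 0" "a \<le> b"
  shows rho_primitive_centered_has_integral:
      "((\<lambda>x. rho_primitive k x - rho_primitive_mean k a b) has_integral 0) {a..b}"
    and rho_primitive_variance_has_integral:
      "((\<lambda>x. (norm (rho_primitive k x - rho_primitive_mean k a b))\<^sup>2) has_integral cell_defect k (b - a)) {a..b}"
proof -
  define c where "c = rho_primitive_mean k a b"
  define w where "w = 2 * pi * k"
  define J where "J = \<i> / of_real w * (rho_primitive k b - rho_primitive k a)"
  have "w \<noteq> 0" using assms by (simp add: w_def)
  have J: "(rho_primitive k has_integral J) {a..b}"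
    using rho_primitive_has_integral[OF assms] by (simp add: J_def w_def)
  \<comment> \<open>Valid also for \<open>a = b\<close>, where both sides are zero.\<close>
  have Jc: "J = c * of_real (b - a)"
    using J assms(2) by (cases "a = b") (auto simp: c_def rho_primitive_mean_def J_def integral_unique)
  have const: "((\<lambda>x. z) has_integral (b - a) *\<^sub>R z) {a..b}" for z :: "'a :: real_normed_vector"
    using has_integral_const_real[of z a b] assms(2) by simp
  show "((\<lambda>x. rho_primitive k x - rho_primitive_mean k a b) has_integral 0) {a..b}"
    using has_integral_diff[OF J const[of c]] by (simp add: Jc c_def scaleR_conv_of_real)
  have normJ: "(norm J)\<^sup>2 = (2 - 2 * cos (w * (b - a))) / w ^ 4"
  proof -
    have "J = (\<i> / of_real w)\<^sup>2 * (rho k b - rho k a)"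
      by (simp only: J_def rho_primitive_def w_def power2_eq_square right_diff_distrib mult.assoc)
    then have "(norm J)\<^sup>2 = (1 / w\<^sup>2)\<^sup>2 * (norm (rho k b - rho k a))\<^sup>2"
      by (simp add: norm_mult norm_divide norm_power power_mult_distrib power_divide)
    then show ?thesis
      by (simp add: norm_rho_diff_square w_def power_divide flip: power_mult)
  qed
  \<comment> \<open>The cross term in the expansion of the square of
    \<open>norm (rho_primitive k x - c)\<close>.\<close>
  have "((\<lambda>x. Re (cnj c * rho_primitive k x)) has_integral Re (cnj c * J)) {a..b}"
    using has_integral_linear[OF has_integral_mult_right[OF J, of "cnj c"] bounded_linear_Re] by (simp add: o_def)
  from has_integral_add[OF has_integral_diff[OF const[of "1 / w\<^sup>2"] has_integral_mult_right[OF this, of 2]] const[of "(norm c)\<^sup>2"]]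
  have "((\<lambda>x. 1 / w\<^sup>2 - 2 * Re (cnj c * rho_primitive k x) + (norm c)\<^sup>2) has_integral
     (b - a) / w\<^sup>2 - 2 * Re (cnj c * J) + (b - a) * (norm c)\<^sup>2) {a..b}"
    by simp
  moreover have "1 / w\<^sup>2 - 2 * Re (cnj c * rho_primitive k x) + (norm c)\<^sup>2 = (norm (rho_primitive k x - c))\<^sup>2" for x
  proof -
    have "(norm (rho_primitive k x))\<^sup>2 = 1 / w\<^sup>2"
      by (simp only: norm_rho_primitive w_def power_divide power2_abs power_one)
    then show ?thesis
      by (simp add: cmod_power2 power2_diff algebra_simps)
  qed
  moreover have "(b - a) / w\<^sup>2 - 2 * Re (cnj c * J) + (b - a) * (norm c)\<^sup>2 = cell_defect k (b - a)"
  proof -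
    have "Re (cnj c * J) = (b - a) * (norm c)\<^sup>2"
      unfolding Jc cmod_power2 by (simp add: power2_eq_square algebra_simps)
    moreover have "(b - a) * (norm c)\<^sup>2 = (norm J)\<^sup>2 / (b - a)"
      using assms(2) by (cases "a = b") (auto simp: Jc norm_mult power2_eq_square simp del: of_real_diff)
    ultimately have "(b - a) / w\<^sup>2 - 2 * Re (cnj c * J) + (b - a) * (norm c)\<^sup>2
        = (b - a) / w\<^sup>2 - (norm J)\<^sup>2 / (b - a)"
      by linarith
    also have "\<dots> = cell_defect k (b - a)"
      unfolding normJ cell_defect_def w_def[symmetric]
      by (simp add: diff_divide_distrib power2_eq_square power4_eq_xxxx mult_ac)
    finally show ?thesis .
  qed
  ultimately show "((\<lambda>x. (norm (rho_primitive k x - rho_primitive_mean k a b))\<^sup>2)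
      has_integral cell_defect k (b - a)) {a..b}"
    by (simp add: c_def)
qed

lemma cell_defect_nonneg:
  assumes "k \<noteq> 0" "L \<ge> 0"
  shows "cell_defect k L \<ge> 0"
  using has_integral_nonneg[OF rho_primitive_variance_has_integral[OF assms(1), of 0 L]] assms(2) by simp

section \<open>Integrals over partitions and the upper bound\<close>

lemma partition_le:
  fixes t :: "nat \<Rightarrow> 'a :: order"
  assumes mono: "\<And>j. j < N \<Longrightarrow> t j \<le> t (Suc j)" and "i \<le> j" "j \<le> N"
  shows "t i \<le> t j"
  using \<open>i \<le> j\<close> \<open>j \<le> N\<close>
proof (induction j rule: dec_induct)
  case (step n)
  then show ?case using mono[of n] by (meson Suc_le_lessD Suc_leD order_trans)
qed simp

lemma has_integral_partition:
  fixes f :: "real \<Rightarrow> 'a :: banach"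
  assumes mono: "\<And>j. j < N \<Longrightarrow> t j \<le> t (Suc j)"
    and int: "\<And>j. j < N \<Longrightarrow> (f has_integral I j) {t j..t (Suc j)}"
  shows "(f has_integral (\<Sum>j<N. I j)) {t 0..t N}"
  using assms
proof (induction N)
  case (Suc N)
  show ?case
    unfolding sum.lessThan_Suc
  proof (rule has_integral_combine)
    show "t 0 \<le> t N" by (rule partition_le[of N]) (use Suc.prems(1) in auto)
    show "t N \<le> t (Suc N)" "(f has_integral I N) {t N..t (Suc N)}"
      using Suc.prems by blast+
    show "(f has_integral (\<Sum>j<N. I j)) {t 0..t N}"
      by (rule Suc.IH; rule Suc.prems; simp)
  qed
qed (use has_integral_refl(2)[of f "t 0"] in simp)

lemma H1_deriv_square_has_integral:
  assumes "f \<in> H1"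
  shows "((\<lambda>x. (norm (deriv01 f x))\<^sup>2) has_integral (H1_seminorm f)\<^sup>2) {0..1}"
proof -
  have "integrable (lebesgue_on {0..1}) (\<lambda>x. (norm (deriv01 f x))\<^sup>2)"
    using assms by (auto simp: H1_def square_integrable01_def)
  from has_integral_integral_lebesgue_on[OF this] show ?thesis
    by (simp add: H1_seminorm_def)
qed

lemma I_rho_has_integral:
  assumes "f \<in> H1"
  shows "((\<lambda>x. f x * rho k x) has_integral I_rho k f) {0..1}"
proof -
  have "continuous_on {0..1} (\<lambda>x. f x * rho k x)"
    using assms abs_continuous_on_imp_continuous_on by (intro continuous_intros) (auto simp: H1_def)
  then have "integrable (lebesgue_on {0..1}) (\<lambda>x. f x * rho k x)"
    by (rule continuous_imp_integrable_real)
  from has_integral_integral_lebesgue_on[OF this] show ?thesis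
    by (simp add: I_rho_def)
qed

text \<open>Integrating by parts on each cell with the primitive of \<open>rho k\<close> of mean zero leaves an integral
  that is bounded by the pointwise inequality \<open>u v \<le> (\<epsilon> u\<^sup>2 + v\<^sup>2 / \<epsilon>) / 2\<close>, with
  \<open>\<epsilon>\<close> optimised at the end.\<close>

lemma H1_quadrature_error:
  fixes t :: "nat \<Rightarrow> real"
  assumes "k \<noteq> 0" and mono: "\<And>j. j < N \<Longrightarrow> t j \<le> t (Suc j)" and t: "t 0 = 0" "t N = 1"
    and f: "f \<in> H1" "H1_seminorm f \<le> 1"
  defines "m \<equiv> \<lambda>j. rho_primitive_mean k (t j) (t (Suc j))"
  defines "E \<equiv> \<Sum>j<N. cell_defect k (t (Suc j) - t j)"
  shows "norm (I_rho k f - (\<Sum>j<N. f (t (Suc j)) * (rho_primitive k (t (Suc j)) - m j)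
                    - f (t j) * (rho_primitive k (t j) - m j))) \<le> sqrt E"
proof -
  have tle: "t i \<le> t j" if "i \<le> j" "j \<le> N" for i j
    using partition_le[of N t, OF mono] that by simp
  have t01: "0 \<le> t j" "t j \<le> 1" if "j \<le> N" for j
    using tle[of 0 j] tle[of j N] that t by auto
  have sub: "{t j..t (Suc j)} \<subseteq> {0..1}" if "j < N" for j
    using t01[of j] t01[of "Suc j"] that by auto
  define A where "A j = f (t (Suc j)) * (rho_primitive k (t (Suc j)) - m j) - f (t j) * (rho_primitive k (t j) - m j)" for j
  define R where "R j = integral {t j..t (Suc j)} (\<lambda>x. f x * rho k x)" for j
  define V where "V j = integral {t j..t (Suc j)} (\<lambda>x. (norm (deriv01 f x))\<^sup>2)" for j
  have R: "((\<lambda>x. f x * rho k x) has_integral R j) {t j..t (Suc j)}" if "j < N" for j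
    unfolding R_def using integrable_on_subinterval[OF has_integral_integrable[OF I_rho_has_integral[OF f(1)]] sub[OF that]]
    by (rule integrable_integral)
  have V: "((\<lambda>x. (norm (deriv01 f x))\<^sup>2) has_integral V j) {t j..t (Suc j)}" if "j < N" for j
    unfolding V_def
    using integrable_on_subinterval[OF has_integral_integrable[OF H1_deriv_square_has_integral[OF f(1)]] sub[OF that]]
    by (rule integrable_integral)
  have sumR: "(\<Sum>j<N. R j) = I_rho k f"
    using has_integral_partition[of N t, OF mono R] I_rho_has_integral[OF f(1), of k] t
    by (simp add: has_integral_unique)
  have sumV: "(\<Sum>j<N. V j) = (H1_seminorm f)\<^sup>2"
    using has_integral_partition[of N t, OF mono V] H1_deriv_square_has_integral[OF f(1)] t
    by (simp add: has_integral_unique)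
  then have V1: "(\<Sum>j<N. V j) \<le> 1"
    using f(2) by (simp add: power_le_one H1_seminorm_def)
  \<comment> \<open>One parameter \<epsilon> serves all cells, so the sum of the cell bounds
    involves only the total seminorm, at most 1, and \<open>E\<close>.\<close>
  have bound: "norm (I_rho k f - (\<Sum>j<N. A j)) \<le> (\<epsilon> + E / \<epsilon>) / 2" if "\<epsilon> > 0" for \<epsilon>
  proof -
    have cell: "norm (R j - A j) \<le> (\<epsilon> * V j + cell_defect k (t (Suc j) - t j) / \<epsilon>) / 2" if "j < N" for j
    proof -
      let ?D = "\<lambda>x. deriv01 f x * (rho_primitive k x - m j)"
      let ?B = "\<lambda>x. (\<epsilon> * (norm (deriv01 f x))\<^sup>2 + (norm (rho_primitive k x - m j))\<^sup>2 / \<epsilon>) / 2"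
      have "((\<lambda>x. ?D x + f x * rho k x) has_integral A j) {t j..t (Suc j)}"
        unfolding A_def using t01[of j] t01[of "Suc j"] mono[OF that] that
        by (intro H1_integration_by_parts f \<open>k \<noteq> 0\<close>) auto
      from has_integral_diff[OF this R[OF that]]
      have D: "(?D has_integral A j - R j) {t j..t (Suc j)}" by simp
      have B: "(?B has_integral (\<epsilon> * V j + cell_defect k (t (Suc j) - t j) / \<epsilon>) / 2) {t j..t (Suc j)}"
        using rho_primitive_variance_has_integral[OF \<open>k \<noteq> 0\<close> mono[OF that]]
        by (intro has_integral_divide has_integral_add has_integral_mult_right V[OF that]) (simp add: m_def)
      have "norm (integral {t j..t (Suc j)} ?D) \<le> integral {t j..t (Suc j)} ?B"
      proof (rule integral_norm_bound_integral)
        fix x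
        define u where "u = norm (deriv01 f x)"
        define v where "v = norm (rho_primitive k x - m j)"
        have "0 \<le> (\<epsilon> * u - v)\<^sup>2" by simp
        then have "u * v \<le> (\<epsilon> * u\<^sup>2 + v\<^sup>2 / \<epsilon>) / 2"
          using \<open>\<epsilon> > 0\<close> by (simp add: field_simps power2_eq_square)
        then show "norm (?D x) \<le> ?B x" by (simp add: u_def v_def norm_mult)
      qed (use D B in \<open>auto intro: has_integral_integrable\<close>)
      then show ?thesis
        unfolding integral_unique[OF D] integral_unique[OF B] by (simp only: norm_minus_commute)
    qed
    have "norm (I_rho k f - (\<Sum>j<N. A j)) = norm (\<Sum>j<N. R j - A j)"
      by (simp add: sumR[symmetric] sum_subtractf)
    also have "\<dots> \<le> (\<Sum>j<N. (\<epsilon> * V j + cell_defect k (t (Suc j) - t j) / \<epsilon>) / 2)"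
      by (rule sum_norm_le) (use cell in auto)
    also have "\<dots> = (\<epsilon> * (\<Sum>j<N. V j) + E / \<epsilon>) / 2"
      by (simp add: E_def sum.distrib sum_distrib_left sum_divide_distrib add_divide_distrib)
    also have "\<dots> \<le> (\<epsilon> + E / \<epsilon>) / 2"
      using V1 \<open>\<epsilon> > 0\<close> by simp
    finally show ?thesis .
  qed
  have "E \<ge> 0"
    unfolding E_def using mono by (intro sum_nonneg cell_defect_nonneg \<open>k \<noteq> 0\<close>) simp
  have "norm (I_rho k f - (\<Sum>j<N. A j)) \<le> sqrt E"
  \<comment> \<open>The optimal parameter is \<open>sqrt E\<close>; when it is zero it is not
    admissible, and \<epsilon> tends to zero instead.\<close>
  proof (cases "E = 0")
    case True
    have "norm (I_rho k f - (\<Sum>j<N. A j)) \<le> 0 + \<epsilon>" if "\<epsilon> > 0" for \<epsilon>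
      using bound[of \<epsilon>] True that by simp
    then show ?thesis using True by (metis field_le_epsilon real_sqrt_zero)
  next
    case False
    then show ?thesis
      using bound[of "sqrt E"] \<open>E \<ge> 0\<close> by (simp add: real_div_sqrt)
  qed
  then show ?thesis by (simp add: A_def)
qed

subsection \<open>Fooling functions\<close>

text \<open>Lets a cellwise function be written as one formula. Cells are half-open, so those
  created by repeated nodes are empty and \<open>LEAST\<close> skips them.\<close>

lemma partition_cell_Least:
  fixes t :: "nat \<Rightarrow> real"
  assumes mono: "\<And>j. j < N \<Longrightarrow> t j \<le> t (Suc j)" and "j < N" "t j \<le> x" "x < t (Suc j)"
  shows "(LEAST j. x < t (Suc j)) = j"
proof (rule Least_equality)
  fix i assume i: "x < t (Suc i)"
  show "j \<le> i"
  proof (rule ccontr)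
    assume "\<not> j \<le> i"
    then have "t (Suc i) \<le> t j" using \<open>j < N\<close> by (intro partition_le[of N t, OF mono]) auto
    with i assms show False by simp
  qed
qed (rule assms)

lemma partition_cell_exists:
  fixes t :: "nat \<Rightarrow> real"
  assumes "x \<in> {t 0..t N}" "x \<notin> t ` {..N}"
  obtains j where "j < N" "t j < x" "x < t (Suc j)"
  using assms
proof (induction N arbitrary: thesis)
  case (Suc N)
  have "x \<noteq> t (Suc N)" "x \<noteq> t N" using Suc.prems(3) by auto
  then consider "x < t N" | "t N < x \<and> x < t (Suc N)" using Suc.prems(2) by fastforce
  then show ?case
  proof cases
    case 1
    show ?thesis
    proof (rule Suc.IH)
      show "x \<in> {t 0..t N}" "x \<notin> t ` {..N}" using 1 Suc.prems by auto
      show thesis if "j < N" "t j < x" "x < t (Suc j)" for j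
        using Suc.prems(1)[of j] that by simp
    qed
  next
    case 2
    then show ?thesis using Suc.prems(1)[of N] by auto
  qed
qed auto

text \<open>Equality case of Cauchy-Schwarz: up to sign, \<open>f'\<close> is \<open>r\<close> times
  the conjugate of the primitive minus its cell mean. Having mean zero on each cell, it integrates
  to a function vanishing at all nodes. The free factor \<open>r\<close> later provides both
  normalisation and sign.\<close>

lemma H1_0_fooling_function:
  fixes t :: "nat \<Rightarrow> real" and r :: real
  assumes "k \<noteq> 0" and mono: "\<And>j. j < N \<Longrightarrow> t j \<le> t (Suc j)" and t: "t 0 = 0" "t N = 1"
  defines "E \<equiv> \<Sum>j<N. cell_defect k (t (Suc j) - t j)"
  obtains f where "f \<in> H1_0" "\<And>j. j \<le> N \<Longrightarrow> f (t j) = 0"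
    "H1_seminorm f = \<bar>r\<bar> * sqrt E" "I_rho k f = of_real (r * E)"
proof -
  define m where "m j = rho_primitive_mean k (t j) (t (Suc j))" for j
  define h where "h j x = of_real r * cnj (rho_primitive k x - m j)" for j x
  define g where "g x = h (LEAST j. x < t (Suc j)) x" for x
  \<comment> \<open>The minus sign cancels the one from integration by parts, so that the integral
    becomes \<open>+ r * E\<close>.\<close>
  define f where "f x = - integral {0..x} g" for x
  define T where "T = t ` {..N}"
  have tle: "t i \<le> t j" if "i \<le> j" "j \<le> N" for i j
    using partition_le[of N t, OF mono] that by simp
  have t01: "0 \<le> t j" "t j \<le> 1" if "j \<le> N" for j
    using tle[of 0 j] tle[of j N] that t by auto
  have gh: "g x = h j x" if "j < N" "t j \<le> x" "x < t (Suc j)" for j x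
    unfolding g_def using partition_cell_Least[of N t, OF mono] that by simp
  \<comment> \<open>The right end point belongs to the next cell; a single point does not affect the
    integrals.\<close>
  have gh': "g x = h j x" if "j < N" "x \<in> {t j..t (Suc j)} - {t (Suc j)}" for j x
    using gh that by auto
  have nh: "norm (h j x) \<le> \<bar>r\<bar> * (2 / \<bar>2 * pi * k\<bar>)" for j x
  proof -
    have "norm (rho_primitive k x - m j) \<le> 1 / \<bar>2 * pi * k\<bar> + 1 / \<bar>2 * pi * k\<bar>"
      using norm_triangle_ineq4[of "rho_primitive k x" "m j"] norm_rho_primitive[of k x]
        norm_rho_primitive_mean_le[of k "t j" "t (Suc j)"] unfolding m_def by linarith
    then show ?thesis
      unfolding h_def norm_mult norm_of_real complex_mod_cnj by (intro mult_left_mono) auto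
  qed
  have h0: "(h j has_integral 0) {t j..t (Suc j)}" if "j < N" for j
    using has_integral_mult_right[OF has_integral_linear[OF rho_primitive_centered_has_integral[OF \<open>k \<noteq> 0\<close> mono[OF that]]
        bounded_linear_cnj], of "of_real r"]
    by (simp add: h_def[abs_def] m_def o_def)
  have g0: "(g has_integral 0) {t j..t (Suc j)}" if "j < N" for j
    using has_integral_spike_finite[of "{t (Suc j)}", OF _ gh'[OF that] h0[OF that]] by simp
  have gint: "(g has_integral 0) {0..t j}" if "j \<le> N" for j
    using has_integral_partition[of j t g "\<lambda>_. 0"] mono g0 that t by simp
  have g_on: "g integrable_on {0..1}"
    using gint[of N] t by auto
  have f0: "f (t j) = 0" if "j \<le> N" for j
    using gint[OF that] by (simp add: f_def integral_unique)
  \<comment> \<open>The \<open>+ 1\<close> makes the Lipschitz constant positive even for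
    \<open>r = 0\<close>.\<close>
  define C where "C = \<bar>r\<bar> * (2 / \<bar>2 * pi * k\<bar>) + 1"
  have "C > 0" by (simp add: C_def add_nonneg_pos)
  \<comment> \<open>The bound \<open>nh\<close> holds for every index, hence also where
    \<open>LEAST\<close> does not select one of the cells, as at \<open>x = 1\<close>.\<close>
  have ng: "norm (g x) \<le> C" for x
    using nh[of "LEAST j. x < t (Suc j)" x] unfolding g_def C_def by simp
  have ac: "abs_continuous_on {0..1} f"
  proof (rule abs_continuous_on_lipschitz[OF \<open>C > 0\<close>])
    fix x y :: real assume xy: "x \<in> {0..1}" "y \<in> {0..1}" "x \<le> y"
    have i: "g integrable_on {0..y}" "g integrable_on {x..y}"
      using xy by (intro integrable_on_subinterval[OF g_on]; simp)+
    have "integral {0..x} g + integral {x..y} g = integral {0..y} g"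
      using xy i by (intro Henstock_Kurzweil_Integration.integral_combine) auto
    then have "f y - f x = - integral {x..y} g"
      unfolding f_def by (metis add_diff_cancel_left' minus_diff_eq minus_diff_minus)
    then have "norm (f y - f x) = norm (integral {x..y} g)" by simp
    also have "\<dots> \<le> C * measure lborel (cbox x y)"
      using has_integral_bound[of C g "integral {x..y} g" x y] integrable_integral[OF i(2)] ng \<open>C > 0\<close>
      by simp
    finally show "norm (f y - f x) \<le> C * (y - x)" using xy by simp
  qed
  have "finite T" by (simp add: T_def)
  have deriv: "(f has_vector_derivative - g x) (at x within {0..1})" if x: "x \<in> {0..1} - T" for x
  proof -
    obtain j where j: "j < N" "t j < x" "x < t (Suc j)"
      by (rule partition_cell_exists[of x t N]) (use x t in \<open>auto simp: T_def\<close>)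
    have "isCont (h j) x"
      unfolding h_def using continuous_on_rho_primitive[of UNIV k]
      by (intro continuous_intros) (auto simp: continuous_on_eq_continuous_at)
    moreover have "eventually (\<lambda>y. y \<in> {t j<..<t (Suc j)}) (nhds x)"
      using j by (intro eventually_nhds_in_open) auto
    then have "eventually (\<lambda>y. g y = h j y) (nhds x)"
      by (rule eventually_mono) (use gh[OF j(1)] in auto)
    ultimately have "isCont g x"
      using isCont_cong[of g "h j" x] by simp
    then have "continuous (at x within ({0..1} - T)) g"
      by (rule continuous_at_imp_continuous_at_within)
    from integral_has_vector_derivative_continuous_at[OF g_on x \<open>finite T\<close> this]
    have "((\<lambda>u. integral {0..u} g) has_vector_derivative g x) (at x within ({0..1} - T))" .
    \<comment> \<open>The finite set \<open>T\<close> is closed, so removing it does not change the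
      filter at a point outside it.\<close>
    moreover have "at x within ({0..1} - T) = at x within {0..1}"
      using x \<open>finite T\<close> by (intro at_within_nhd[of x "- T"]) (auto intro: finite_imp_closed)
    ultimately show ?thesis
      unfolding f_def by (auto intro: has_vector_derivative_minus)
  qed
  have d01: "deriv01 f x = - g x" if "x \<in> {0..1} - T" for x
    unfolding deriv01_def using deriv[OF that] that by (intro vector_derivative_within_closed_interval) auto
  \<comment> \<open>Integrability of \<open>deriv01 f\<close>, whatever its values at the nodes,
    supplies the measurability demanded by \<open>H1\<close>.\<close>
  have spike: "(deriv01 f has_integral 0) {0..1}"
    by (rule has_integral_spike_finite[OF \<open>finite T\<close> d01]) (use has_integral_neg[OF gint[of N]] t in auto)
  have sq: "((\<lambda>x. (norm (deriv01 f x))\<^sup>2) has_integral r\<^sup>2 * E) {0..1}"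
  proof (rule has_integral_spike_finite[OF \<open>finite T\<close>])
    show "(norm (deriv01 f x))\<^sup>2 = (norm (g x))\<^sup>2" if "x \<in> {0..1} - T" for x
      using d01[OF that] by simp
    have "((\<lambda>x. (norm (g x))\<^sup>2) has_integral r\<^sup>2 * cell_defect k (t (Suc j) - t j)) {t j..t (Suc j)}" if "j < N" for j
    proof (rule has_integral_spike_finite[of "{t (Suc j)}"])
      show "(norm (g x))\<^sup>2 = r\<^sup>2 * (norm (rho_primitive k x - m j))\<^sup>2"
        if "x \<in> {t j..t (Suc j)} - {t (Suc j)}" for x
        using gh'[OF \<open>j < N\<close> that]
        by (simp add: h_def norm_mult power_mult_distrib del: complex_cnj_diff)
    qed (use has_integral_mult_right[OF rho_primitive_variance_has_integral[OF \<open>k \<noteq> 0\<close> mono[OF that]], of "r\<^sup>2"]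
          in \<open>auto simp: m_def\<close>)
    from has_integral_partition[of N t, OF mono this]
    show "((\<lambda>x. (norm (g x))\<^sup>2) has_integral r\<^sup>2 * E) {0..1}"
      by (simp add: E_def sum_distrib_left t)
  qed
  have fH1: "f \<in> H1"
    unfolding H1_def square_integrable01_def mem_Collect_eq
  proof (intro conjI ac)
    show "deriv01 f \<in> borel_measurable (lebesgue_on {0..1})"
      using spike by (intro integrable_imp_measurable) auto
    show "integrable (lebesgue_on {0..1}) (\<lambda>x. (norm (deriv01 f x))\<^sup>2)"
      using sq by (intro absolutely_integrable_imp_integrable nonnegative_absolutely_integrable_1) auto
    have "AE x in lebesgue. x \<notin> T"
      using \<open>finite T\<close> by (simp add: AE_not_in negligible_iff_null_sets[symmetric] negligible_finite)
    then have "AE x in lebesgue. x \<in> {0..1} \<longrightarrow> f differentiable at x within {0..1}"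
      by (rule AE_mp) (intro AE_I2 impI differentiableI_vector[OF deriv], simp)
    then show "AE x in lebesgue_on {0..1}. f differentiable at x within {0..1}"
      by (simp add: AE_restrict_space_iff)
  qed
  show thesis
  proof (rule that)
    show "f \<in> H1_0" using fH1 f0[of 0] f0[of N] t by (simp add: H1_0_def)
    show "f (t j) = 0" if "j \<le> N" for j by (rule f0[OF that])
    have "(H1_seminorm f)\<^sup>2 = r\<^sup>2 * E"
      using H1_deriv_square_has_integral[OF fH1] sq by (rule has_integral_unique)
    then have "sqrt ((H1_seminorm f)\<^sup>2) = \<bar>r\<bar> * sqrt E"
      by (simp add: real_sqrt_mult)
    then show "H1_seminorm f = \<bar>r\<bar> * sqrt E"
      by (simp add: H1_seminorm_def)
    \<comment> \<open>Write the primitive as its deviation from \<open>m j\<close> plus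
      \<open>m j\<close>: the first part gives \<open>r\<close> times the variance, the second
      integrates to zero with \<open>h j\<close>.\<close>
    have "((\<lambda>x. g x * rho_primitive k x) has_integral of_real r * of_real (cell_defect k (t (Suc j) - t j))) {t j..t (Suc j)}"
      if "j < N" for j
    proof (rule has_integral_spike_finite[of "{t (Suc j)}"])
      show "g x * rho_primitive k x = of_real r * of_real ((norm (rho_primitive k x - m j))\<^sup>2) + h j x * m j"
        if "x \<in> {t j..t (Suc j)} - {t (Suc j)}" for x
        unfolding gh'[OF \<open>j < N\<close> that] complex_norm_square h_def by (simp add: algebra_simps)
      show "((\<lambda>x. of_real r * of_real ((norm (rho_primitive k x - m j))\<^sup>2) + h j x * m j) has_integral
          of_real r * of_real (cell_defect k (t (Suc j) - t j))) {t j..t (Suc j)}"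
        using has_integral_add[OF has_integral_mult_right[OF has_integral_of_real[OF
            rho_primitive_variance_has_integral[OF \<open>k \<noteq> 0\<close> mono[OF that]]]] has_integral_mult_left[OF h0[OF that], of "m j"]]
        by (simp add: m_def)
    qed simp
    from has_integral_partition[of N t, OF mono this]
    have "((\<lambda>x. g x * rho_primitive k x) has_integral of_real (r * E)) {0..1}"
      by (simp add: E_def sum_distrib_left t)
    from has_integral_neg[OF this]
    have "((\<lambda>x. deriv01 f x * rho_primitive k x) has_integral - of_real (r * E)) {0..1}"
      by (rule has_integral_spike_finite[OF \<open>finite T\<close>, rotated]) (simp add: d01)
    from has_integral_add[OF this I_rho_has_integral[OF fH1, of k]]
    have "((\<lambda>x. deriv01 f x * rho_primitive k x + f x * rho k x) has_integral
        - of_real (r * E) + I_rho k f) {0..1}" .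
    \<comment> \<open>Integration by parts over the whole interval with \<open>c = 0\<close>; both
      boundary values of \<open>f\<close> vanish.\<close>
    moreover have "((\<lambda>x. deriv01 f x * rho_primitive k x + f x * rho k x) has_integral 0) {0..1}"
      using H1_integration_by_parts[OF fH1 \<open>k \<noteq> 0\<close>, of 0 1 0] f0[of 0] f0[of N] t by simp
    ultimately have "- of_real (r * E) + I_rho k f = 0"
      by (rule has_integral_unique)
    then show "I_rho k f = of_real (r * E)" by simp
  qed
qed

subsection \<open>Bounds for the minimal error\<close>

lemma cos_le_Taylor4: "cos (x::real) \<le> 1 - x\<^sup>2 / 2 + x ^ 4 / 24"
proof -
  obtain t where "cos x = (\<Sum>m<4. cos_coeff m * x ^ m) + (cos (t + 1/2 * real 4 * pi) / fact 4) * x ^ 4"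
    using Maclaurin_cos_expansion[of x 4] by blast
  moreover have "cos (t + 1/2 * real 4 * pi) / fact 4 * x ^ 4 \<le> 1 / 24 * x ^ 4"
    by (intro mult_right_mono) (auto simp: fact_numeral)
  moreover have "(\<Sum>m<4. cos_coeff m * x ^ m) = 1 - x\<^sup>2 / 2"
    by (simp add: lessThan_nat_numeral lessThan_Suc cos_coeff_def fact_numeral)
  ultimately show ?thesis by simp
qed

lemma cos_ge_Taylor6: "cos (x::real) \<ge> 1 - x\<^sup>2 / 2 + x ^ 4 / 24 - x ^ 6 / 720"
proof -
  obtain t where "cos x = (\<Sum>m<6. cos_coeff m * x ^ m) + (cos (t + 1/2 * real 6 * pi) / fact 6) * x ^ 6"
    using Maclaurin_cos_expansion[of x 6] by blast
  moreover have "cos (t + 1/2 * real 6 * pi) / fact 6 * x ^ 6 \<ge> (- 1) / 720 * x ^ 6"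
    by (intro mult_right_mono) (auto simp: fact_numeral intro: divide_right_mono)
  moreover have "(\<Sum>m<6. cos_coeff m * x ^ m) = 1 - x\<^sup>2 / 2 + x ^ 4 / 24"
    by (simp add: lessThan_nat_numeral lessThan_Suc cos_coeff_def fact_numeral)
  ultimately show ?thesis by simp
qed

text \<open>The linear bounds use only that \<open>Q\<close> lies between 0 and 4 and serve large
  \<open>k\<close>; the cubic ones come from the Taylor bounds and serve short cells. The loss in
  the linear lower bound does not depend on \<open>L\<close>, so summing it requires only the number
  of cells.\<close>

lemma
  assumes "k \<noteq> 0" "L \<ge> 0"
  shows cell_defect_le_linear: "cell_defect k L \<le> L / (2 * pi * k)\<^sup>2"
    and cell_defect_ge_linear: "cell_defect k L \<ge> (L - 2 / \<bar>2 * pi * k\<bar>) / (2 * pi * k)\<^sup>2"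
    and cell_defect_le_cubic: "cell_defect k L \<le> L ^ 3 / 12"
    and cell_defect_ge_cubic: "cell_defect k L \<ge> L ^ 3 / 12 - (2 * pi * k)\<^sup>2 * L ^ 5 / 360"
proof -
  define w where "w = 2 * pi * k"
  have "w \<noteq> 0" using assms by (simp add: w_def)
  define Q where "Q = 2 - 2 * cos (w * L)"
  have Q0: "Q \<ge> 0" and Q4: "Q \<le> 4"
    using cos_le_one[of "w * L"] cos_ge_minus_one[of "w * L"] by (simp_all add: Q_def del: cos_le_one cos_ge_minus_one)
  have def: "cell_defect k L = (L - Q / (w\<^sup>2 * L)) / w\<^sup>2"
    by (simp add: cell_defect_def Q_def w_def)
  show "cell_defect k L \<le> L / (2 * pi * k)\<^sup>2"
    unfolding def w_def[symmetric] using assms(2) Q0 \<open>w \<noteq> 0\<close> by (intro divide_right_mono) auto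
  show "cell_defect k L \<ge> (L - 2 / \<bar>2 * pi * k\<bar>) / (2 * pi * k)\<^sup>2"
    unfolding w_def[symmetric]
  \<comment> \<open>For shorter cells the claimed lower bound is not positive; for the others
    \<open>4 / (w\<^sup>2 * L)\<close> is at most \<open>2 / \<bar>w\<bar>\<close>.\<close>
  proof (cases "L < 2 / \<bar>w\<bar>")
    case True
    then have "(L - 2 / \<bar>w\<bar>) / w\<^sup>2 \<le> 0" by (intro divide_nonpos_nonneg) auto
    then show "(L - 2 / \<bar>w\<bar>) / w\<^sup>2 \<le> cell_defect k L" using cell_defect_nonneg[OF assms] by linarith
  next
    case False
    then have "2 \<le> \<bar>w\<bar> * L" using \<open>w \<noteq> 0\<close> by (simp add: field_simps)
    have "L > 0" using False \<open>w \<noteq> 0\<close> by (smt (verit) divide_pos_pos zero_less_abs_iff)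
    have "Q / (w\<^sup>2 * L) \<le> 4 / (w\<^sup>2 * L)"
      using Q4 \<open>L > 0\<close> by (intro divide_right_mono) auto
    also have "\<dots> \<le> 2 / \<bar>w\<bar>"
    proof -
      have "w\<^sup>2 * L = \<bar>w\<bar> * (\<bar>w\<bar> * L)" by (simp add: power2_eq_square)
      then have "2 * \<bar>w\<bar> \<le> w\<^sup>2 * L"
        using mult_left_mono[OF \<open>2 \<le> \<bar>w\<bar> * L\<close>, of "\<bar>w\<bar>"] by linarith
      then have "4 / (w\<^sup>2 * L) \<le> 4 / (2 * \<bar>w\<bar>)"
        using \<open>w \<noteq> 0\<close> by (intro divide_left_mono mult_pos_pos) (use \<open>L > 0\<close> in auto)
      then show ?thesis by simp
    qed
    finally show "(L - 2 / \<bar>w\<bar>) / w\<^sup>2 \<le> cell_defect k L"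
      unfolding def by (intro divide_right_mono) auto
  qed
  show "cell_defect k L \<le> L ^ 3 / 12"
  proof (cases "L = 0")
    case False
    then have "L > 0" using assms(2) by simp
    have "(w * L)\<^sup>2 - (w * L) ^ 4 / 12 \<le> Q"
      using cos_le_Taylor4[of "w * L"] by (simp add: Q_def)
    then have "((w * L)\<^sup>2 - (w * L) ^ 4 / 12) / (w\<^sup>2 * L) \<le> Q / (w\<^sup>2 * L)"
      using \<open>L > 0\<close> by (intro divide_right_mono) auto
    moreover have "((w * L)\<^sup>2 - (w * L) ^ 4 / 12) / (w\<^sup>2 * L) = L - w\<^sup>2 * (L ^ 3 / 12)"
      using \<open>L > 0\<close> \<open>w \<noteq> 0\<close> by (simp add: field_simps eval_nat_numeral)
    ultimately have "(L - Q / (w\<^sup>2 * L)) / w\<^sup>2 \<le> (w\<^sup>2 * (L ^ 3 / 12)) / w\<^sup>2"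
      by (intro divide_right_mono) auto
    then show ?thesis unfolding def using \<open>w \<noteq> 0\<close> by simp
  qed (simp add: cell_defect_def)
  show "cell_defect k L \<ge> L ^ 3 / 12 - (2 * pi * k)\<^sup>2 * L ^ 5 / 360"
    unfolding w_def[symmetric]
  proof (cases "L = 0")
    case False
    then have "L > 0" using assms(2) by simp
    have "Q \<le> (w * L)\<^sup>2 - (w * L) ^ 4 / 12 + (w * L) ^ 6 / 360"
      using cos_ge_Taylor6[of "w * L"] by (simp add: Q_def)
    then have "Q / (w\<^sup>2 * L) \<le> ((w * L)\<^sup>2 - (w * L) ^ 4 / 12 + (w * L) ^ 6 / 360) / (w\<^sup>2 * L)"
      using \<open>L > 0\<close> by (intro divide_right_mono) auto
    moreover have "((w * L)\<^sup>2 - (w * L) ^ 4 / 12 + (w * L) ^ 6 / 360) / (w\<^sup>2 * L)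
        = L - w\<^sup>2 * (L ^ 3 / 12 - w\<^sup>2 * L ^ 5 / 360)"
      using \<open>L > 0\<close> \<open>w \<noteq> 0\<close> by (simp add: field_simps eval_nat_numeral)
    ultimately have "(w\<^sup>2 * (L ^ 3 / 12 - w\<^sup>2 * L ^ 5 / 360)) / w\<^sup>2 \<le> (L - Q / (w\<^sup>2 * L)) / w\<^sup>2"
      by (intro divide_right_mono) auto
    then show "L ^ 3 / 12 - w\<^sup>2 * L ^ 5 / 360 \<le> cell_defect k L"
      unfolding def using \<open>w \<noteq> 0\<close> by simp
  qed (simp add: cell_defect_def)
qed

section \<open>From partitions to minimal errors\<close>

text \<open>The boundary terms of integration by parts involve only node values and thus form an
  algorithm. \<open>N\<close> cells have \<open>N + 1\<close> nodes, whence
  \<open>N < n\<close>.\<close>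

lemma minimal_error_le:
  fixes t :: "nat \<Rightarrow> real"
  assumes "k \<noteq> 0" "N < n" and mono: "\<And>j. j < N \<Longrightarrow> t j \<le> t (Suc j)" and t: "t 0 = 0" "t N = 1"
  shows "minimal_error n (I_rho k) H1 \<le> ennreal (sqrt (\<Sum>j<N. cell_defect k (t (Suc j) - t j)))"
proof -
  define m where "m j = rho_primitive_mean k (t j) (t (Suc j))" for j
  define xs where "xs = map t [0..<Suc N]"
  define \<phi> where "\<phi> zs = (\<Sum>j<N. zs ! Suc j * (rho_primitive k (t (Suc j)) - m j)
                    - zs ! j * (rho_primitive k (t j) - m j))" for zs
  have "t j \<in> {0..1}" if "j \<le> N" for j
    using partition_le[of N t 0 j, OF mono] partition_le[of N t j N, OF mono] that t by auto
  then have "(\<lambda>f. \<phi> (map f xs)) \<in> algorithms n"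
    unfolding algorithms_def mem_Collect_eq using \<open>N < n\<close>
    by (intro exI[of _ xs] exI[of _ \<phi>]) (auto simp: xs_def simp del: upt_Suc)
  moreover have "norm (I_rho k f - \<phi> (map f xs)) \<le> sqrt (\<Sum>j<N. cell_defect k (t (Suc j) - t j))"
    if "f \<in> H1" "H1_seminorm f \<le> 1" for f
  proof -
    have "map f xs ! j = f (t j)" if "j \<le> N" for j
      using that by (simp add: xs_def del: upt_Suc)
    then have "\<phi> (map f xs) = (\<Sum>j<N. f (t (Suc j)) * (rho_primitive k (t (Suc j)) - m j)
                    - f (t j) * (rho_primitive k (t j) - m j))"
      unfolding \<phi>_def by (intro sum.cong) auto
    then show ?thesis
      using H1_quadrature_error[OF \<open>k \<noteq> 0\<close> mono t that] by (simp add: m_def)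
  qed
  ultimately show ?thesis
    unfolding minimal_error_def
    by (intro INF_lower2[where i = "\<lambda>f. \<phi> (map f xs)"] SUP_least ennreal_leI) auto
qed

text \<open>The extra points \<open>gs\<close> refine an arbitrary node set: a function vanishing also there is still
  indistinguishable from zero, and the refined cells are short.\<close>

lemma minimal_error_ge:
  assumes "k \<noteq> 0" and gs: "set gs \<subseteq> {0..1}" "0 \<in> set gs" "1 \<in> set gs"
    and B: "\<And>t N. \<lbrakk>N < n + length gs; \<And>i j. i \<le> j \<Longrightarrow> j \<le> N \<Longrightarrow> t i \<le> t j; t 0 = 0; t N = 1;
        set gs \<subseteq> t ` {..N}\<rbrakk> \<Longrightarrow> B \<le> sqrt (\<Sum>j<N. cell_defect k (t (Suc j) - t j))"
  shows "ennreal B \<le> minimal_error n (I_rho k) H1_0"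
  unfolding minimal_error_def
proof (rule INF_greatest)
  fix A assume "A \<in> algorithms n"
  then obtain xs \<phi> where xs: "length xs \<le> n" "set xs \<subseteq> {0..1}" and A: "A = (\<lambda>f. \<phi> (map f xs))"
    by (auto simp: algorithms_def)
  define ys where "ys = sort (xs @ gs)"
  define N where "N = length ys - 1"
  define t where "t j = ys ! j" for j
  have set_ys: "set ys = set xs \<union> set gs" by (simp add: ys_def)
  have len: "length ys = Suc N"
    using gs(2) by (cases gs) (auto simp: N_def ys_def)
  have mono: "t i \<le> t j" if "i \<le> j" "j \<le> N" for i j
    unfolding t_def using that len by (intro sorted_nth_mono) (auto simp: ys_def)
  have image: "t ` {..N} = set ys"
    unfolding t_def set_conv_nth len by (auto simp: less_Suc_eq_le)
  have ys01: "set ys \<subseteq> {0..1}" "0 \<in> set ys" "1 \<in> set ys"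
    using set_ys xs gs by auto
  have t01: "t j \<in> {0..1}" if "j \<le> N" for j
    using image ys01(1) that by blast
  have "t 0 = 0"
  proof -
    obtain j where "j \<le> N" "t j = 0" using image ys01(2) by force
    then show ?thesis using mono[of 0 j] t01[of 0] by auto
  qed
  have "t N = 1"
  proof -
    obtain j where "j \<le> N" "t j = 1" using image ys01(3) by force
    then show ?thesis using mono[of j N] t01[of N] by auto
  qed
  define E where "E = (\<Sum>j<N. cell_defect k (t (Suc j) - t j))"
  have "E \<ge> 0"
    unfolding E_def using mono by (intro sum_nonneg cell_defect_nonneg \<open>k \<noteq> 0\<close>) auto
  have BE: "B \<le> sqrt E"
    unfolding E_def
  proof (rule B)
    show "N < n + length gs" using len xs(1) by (simp add: ys_def)
    show "set gs \<subseteq> t ` {..N}" using image set_ys by auto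
  qed (use mono \<open>t 0 = 0\<close> \<open>t N = 1\<close> in auto)
  \<comment> \<open>Normalises the fooling function; for \<open>E = 0\<close> division by zero gives
    \<open>r = 0\<close>, and both facts below persist.\<close>
  define r where "r = 1 / sqrt E"
  have rE: "r * E = sqrt E" and r1: "\<bar>r\<bar> * sqrt E \<le> 1"
    using \<open>E \<ge> 0\<close> by (auto simp: r_def real_div_sqrt)
  have ex: "\<exists>f\<in>H1_0. map f xs = map (\<lambda>_. 0) xs \<and> H1_seminorm f \<le> 1 \<and> I_rho k f = of_real (s * sqrt E)"
    if "\<bar>s\<bar> = 1" for s :: real
  proof -
    obtain f where f: "f \<in> H1_0" "\<And>j. j \<le> N \<Longrightarrow> f (t j) = 0"
      "H1_seminorm f = \<bar>s * r\<bar> * sqrt E" "I_rho k f = of_real (s * r * E)"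
    proof (rule H1_0_fooling_function[of k N t "s * r"])
      show "t j \<le> t (Suc j)" if "j < N" for j using mono[of j "Suc j"] that by simp
    qed (use \<open>k \<noteq> 0\<close> \<open>t 0 = 0\<close> \<open>t N = 1\<close> in \<open>auto simp: E_def\<close>)
    have "f x = 0" if "x \<in> set xs" for x
      using that f(2) image set_ys by (metis UnI1 atMost_iff imageE)
    moreover have "H1_seminorm f \<le> 1" using f(3) r1 that by (simp add: abs_mult)
    moreover have "I_rho k f = of_real (s * sqrt E)" using f(4) rE by (simp add: mult.assoc)
    ultimately show ?thesis using f(1) by (intro bexI[of _ f]) auto
  qed
  obtain f where f: "f \<in> H1_0" "map f xs = map (\<lambda>_. 0) xs" "H1_seminorm f \<le> 1" "I_rho k f = of_real (sqrt E)"
    using ex[of 1] by auto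
  obtain g where g: "g \<in> H1_0" "map g xs = map (\<lambda>_. 0) xs" "H1_seminorm g \<le> 1" "I_rho k g = - of_real (sqrt E)"
    using ex[of "- 1"] by auto
  define z where "z = \<phi> (map (\<lambda>_. 0) xs)"
  \<comment> \<open>The algorithm returns the same \<open>z\<close> for both functions, whose
    integrals are \<open>2 * sqrt E\<close> apart, so it misses one of them by at least
    \<open>sqrt E\<close>.\<close>
  have "2 * sqrt E = norm ((of_real (sqrt E) - z) - (- of_real (sqrt E) - z))"
    using \<open>E \<ge> 0\<close> by (simp flip: mult_2 add: norm_mult)
  also have "\<dots> \<le> norm (of_real (sqrt E) - z) + norm (- of_real (sqrt E) - z)"
    by (rule norm_triangle_ineq4)
  finally have "sqrt E \<le> norm (I_rho k f - A f) \<or> sqrt E \<le> norm (I_rho k g - A g)"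
    unfolding A f(2,4) g(2,4) z_def[symmetric] by linarith
  then have "\<exists>f\<in>{f \<in> H1_0. H1_seminorm f \<le> 1}. ennreal B \<le> ennreal (norm (I_rho k f - A f))"
    using f g BE by (auto intro!: ennreal_leI elim: order_trans)
  then show "ennreal B \<le> (SUP f\<in>{f \<in> H1_0. H1_seminorm f \<le> 1}. ennreal (norm (I_rho k f - A f)))"
    by (meson SUP_upper2)
qed

lemma minimal_error_antimono_space:
  assumes "F \<subseteq> G"
  shows "minimal_error n J F \<le> minimal_error n J G"
  unfolding minimal_error_def using assms by (intro INF_mono' SUP_subset_mono) auto

lemma sum_increments:
  fixes t :: "nat \<Rightarrow> real"
  shows "(\<Sum>j<N. t (Suc j) - t j) = t N - t 0"
  by (induction N) auto

section \<open>Bounds for high frequency\<close>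

text \<open>The two end points alone suffice: a single cell of length 1.\<close>

lemma minimal_error_H1_le_high_frequency:
  assumes "k \<noteq> 0" "n \<ge> 2"
  shows "minimal_error n (I_rho k) H1 \<le> ennreal (1 / \<bar>2 * pi * k\<bar>)"
proof -
  have "minimal_error n (I_rho k) H1 \<le> ennreal (sqrt (\<Sum>j<1. cell_defect k (real (Suc j) - real j)))"
    using assms by (intro minimal_error_le) auto
  also have "\<dots> \<le> ennreal (sqrt (1 / (2 * pi * k)\<^sup>2))"
    using cell_defect_le_linear[OF assms(1), of 1] by (intro ennreal_leI) simp
  also have "sqrt (1 / (2 * pi * k)\<^sup>2) = 1 / \<bar>2 * pi * k\<bar>"
    by (simp only: real_sqrt_divide real_sqrt_abs real_sqrt_one)
  finally show ?thesis .
qed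

text \<open>The boundary values are known to vanish, so the zero algorithm without nodes already
  achieves this, for every \<open>n\<close>.\<close>

lemma minimal_error_H1_0_le_high_frequency:
  assumes "k \<noteq> 0"
  shows "minimal_error n (I_rho k) H1_0 \<le> ennreal (1 / \<bar>2 * pi * k\<bar>)"
proof -
  have alg: "(\<lambda>f. (\<lambda>_. 0) (map f [])) \<in> algorithms n"
    unfolding algorithms_def by (intro CollectI exI[of _ "[]"] exI[of _ "\<lambda>_. 0"]) auto
  have "norm (I_rho k f) \<le> 1 / \<bar>2 * pi * k\<bar>" if f: "f \<in> H1_0" "H1_seminorm f \<le> 1" for f
  proof -
    have "f \<in> H1" "f 0 = 0" "f 1 = 0" using f by (auto simp: H1_0_def)
    then have "norm (I_rho k f) \<le> sqrt (cell_defect k 1)"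
      using H1_quadrature_error[OF assms, of 1 real f] f(2) by simp
    also have "\<dots> \<le> sqrt (1 / (2 * pi * k)\<^sup>2)"
      using cell_defect_le_linear[OF assms(1), of 1] by simp
    also have "\<dots> = 1 / \<bar>2 * pi * k\<bar>"
      by (simp only: real_sqrt_divide real_sqrt_abs real_sqrt_one)
    finally show ?thesis .
  qed
  then show ?thesis
    unfolding minimal_error_def by (intro INF_lower2[OF alg] SUP_least ennreal_leI) auto
qed

text \<open>Adding the end points gives at most \<open>n + 1\<close> cells of total length 1, each
  losing at most \<open>2 / \<bar>w\<bar>\<close>. For small \<open>\<bar>k\<bar>\<close> the
  radicand and hence its \<open>sqrt\<close> are negative, and \<open>ennreal\<close> makes the
  bound trivial.\<close>

lemma minimal_error_H1_0_ge_high_frequency: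
  assumes "k \<noteq> 0"
  shows "ennreal (sqrt (1 - 2 * real (n + 1) / \<bar>2 * pi * k\<bar>) / \<bar>2 * pi * k\<bar>) \<le> minimal_error n (I_rho k) H1_0"
proof (rule minimal_error_ge[OF assms, of "[0, 1]"])
  fix t :: "nat \<Rightarrow> real" and N
  assume N: "N < n + length [0, 1::real]" and mono: "\<And>i j. i \<le> j \<Longrightarrow> j \<le> N \<Longrightarrow> t i \<le> t j"
    and t: "t 0 = 0" "t N = 1"
  let ?w = "\<bar>2 * pi * k\<bar>"
  have "(1 - 2 * real (n + 1) / ?w) / ?w\<^sup>2 \<le> (1 - real N * (2 / ?w)) / ?w\<^sup>2"
    using N by (intro divide_right_mono diff_left_mono) (auto simp: divide_right_mono)
  also have "\<dots> = (\<Sum>j<N. (t (Suc j) - t j - 2 / ?w) / (2 * pi * k)\<^sup>2)"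
    using sum_increments[of t N] t by (simp add: sum_subtractf flip: sum_divide_distrib)
  also have "\<dots> \<le> (\<Sum>j<N. cell_defect k (t (Suc j) - t j))"
    using mono by (intro sum_mono cell_defect_ge_linear assms) auto
  finally have "sqrt ((1 - 2 * real (n + 1) / ?w) / ?w\<^sup>2) \<le> sqrt (\<Sum>j<N. cell_defect k (t (Suc j) - t j))"
    by simp
  then show "sqrt (1 - 2 * real (n + 1) / ?w) / ?w \<le> sqrt (\<Sum>j<N. cell_defect k (t (Suc j) - t j))"
    by (simp only: real_sqrt_divide real_sqrt_abs abs_idempotent)
qed auto

section \<open>Bounds for many nodes\<close>

text \<open>Equidistant nodes including both end points leave \<open>n - 1\<close> equal cells, to
  which the cubic upper bound applies.\<close>

lemma minimal_error_H1_le_many_nodes: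
  assumes "k \<noteq> 0" "n \<ge> 2"
  shows "minimal_error n (I_rho k) H1 \<le> ennreal (1 / (2 * sqrt 3) / (real n - 1))"
proof -
  define N where "N = n - 1"
  have N: "N < n" "N > 0" "real N = real n - 1" using assms(2) by (auto simp: N_def)
  have "minimal_error n (I_rho k) H1
      \<le> ennreal (sqrt (\<Sum>j<N. cell_defect k (real (Suc j) / real N - real j / real N)))"
    using assms N by (intro minimal_error_le) (auto simp: divide_right_mono)
  also have "\<dots> \<le> ennreal (sqrt (\<Sum>j<N. (1 / real N) ^ 3 / 12))"
  proof (intro ennreal_leI real_sqrt_le_mono sum_mono)
    fix j
    have "real (Suc j) / real N - real j / real N = 1 / real N"
      by (simp flip: diff_divide_distrib)
    then show "cell_defect k (real (Suc j) / real N - real j / real N) \<le> (1 / real N) ^ 3 / 12"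
      using cell_defect_le_cubic[OF assms(1), of "1 / real N"] by simp
  qed
  also have "(\<Sum>j<N. (1 / real N) ^ 3 / 12) = (1 / (2 * sqrt 3) / real N)\<^sup>2"
    using N by (simp add: power_mult_distrib power_divide field_simps eval_nat_numeral)
  also have "sqrt \<dots> = 1 / (2 * sqrt 3) / (real n - 1)"
    using N by simp
  finally show ?thesis .
qed

text \<open>The cube lies above its tangent at \<open>y\<close>. Being linear in \<open>x\<close>,
  the tangent can be summed over cells of known total length; this replaces Jensen's
  inequality.\<close>

lemma cube_ge_tangent:
  fixes x y :: real
  assumes "x \<ge> 0" "y \<ge> 0"
  shows "x ^ 3 \<ge> 3 * y\<^sup>2 * x - 2 * y ^ 3"
proof -
  have "0 \<le> (x - y)\<^sup>2 * (x + 2 * y)" using assms by simp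
  also have "\<dots> = x ^ 3 - (3 * y\<^sup>2 * x - 2 * y ^ 3)"
    by (simp add: power2_eq_square power3_eq_cube algebra_simps)
  finally show ?thesis by simp
qed

text \<open>Adding the grid \<open>i / m\<close> forces all cells to have length at most
  \<open>1 / m\<close>, so the quintic error term is absorbed into the cubic one. The price is at
  most \<open>n + m\<close> cells instead of about \<open>n\<close>.\<close>

lemma minimal_error_H1_0_ge_many_nodes:
  assumes "k \<noteq> 0" "m > 0" and pos: "1 / 12 - (2 * pi * k)\<^sup>2 / (360 * (real m)\<^sup>2) \<ge> 0"
  shows "ennreal (sqrt (1 / 12 - (2 * pi * k)\<^sup>2 / (360 * (real m)\<^sup>2)) / real (n + m))
     \<le> minimal_error n (I_rho k) H1_0"
proof (rule minimal_error_ge[OF assms(1), of "map (\<lambda>i. real i / real m) [0..<Suc m]"])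
  let ?gs = "map (\<lambda>i. real i / real m) [0..<Suc m]"
  have set_gs: "set ?gs = (\<lambda>i. real i / real m) ` {..m}"
    by (simp add: atLeast0LessThan lessThan_Suc_atMost del: upt_Suc)
  show "set ?gs \<subseteq> {0..1}" unfolding set_gs using \<open>m > 0\<close> by auto
  have "0 = real 0 / real m" "1 = real m / real m" using \<open>m > 0\<close> by auto
  then show "0 \<in> set ?gs" "1 \<in> set ?gs" unfolding set_gs by blast+
  fix t :: "nat \<Rightarrow> real" and N
  assume N: "N < n + length ?gs" and mono: "\<And>i j. i \<le> j \<Longrightarrow> j \<le> N \<Longrightarrow> t i \<le> t j"
    and t: "t 0 = 0" "t N = 1" and grid: "set ?gs \<subseteq> t ` {..N}"
  define c where "c = 1 / 12 - (2 * pi * k)\<^sup>2 / (360 * (real m)\<^sup>2)"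
  have "N > 0" using t by (cases N) auto
  have "N \<le> n + m" using N by simp
  have gap: "t (Suc j) - t j \<le> 1 / real m" if "j < N" for j
  proof (cases "t (Suc j) = t j")
    case False
    then have lt: "t j < t (Suc j)" using mono[of j "Suc j"] that by simp
    have "0 \<le> t j" "t (Suc j) \<le> 1" using mono[of 0 j] mono[of "Suc j" N] t that by auto
    \<comment> \<open>The first grid point beyond \<open>t j\<close> is \<open>(i + 1) / m\<close>.
      It is a node at distance at most \<open>1 / m\<close>, so the next node comes no
      later.\<close>
    define i where "i = nat \<lfloor>t j * real m\<rfloor>"
    have i: "real i \<le> t j * real m" "t j * real m < real i + 1"
      using \<open>0 \<le> t j\<close> by (auto simp: i_def intro: real_of_int_floor_add_one_gt)
    have "t j * real m < real m" using lt \<open>t (Suc j) \<le> 1\<close> \<open>m > 0\<close> by simp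
    then have "Suc i \<le> m" using i by linarith
    then have "real (Suc i) / real m \<in> t ` {..N}" using grid unfolding set_gs by blast
    then obtain l where l: "l \<le> N" "t l = real (Suc i) / real m" by auto
    have "t j < t l" using i(2) \<open>m > 0\<close> by (simp add: l(2) pos_less_divide_eq)
    then have "Suc j \<le> l" using mono[of l j] that by (meson leD less_imp_le not_less_eq_eq)
    then have "t (Suc j) \<le> t l" using mono l(1) by blast
    also have "t l \<le> t j + 1 / real m" using i(1) l(2) \<open>m > 0\<close> by (simp add: field_simps)
    finally show ?thesis by simp
  qed simp
  \<comment> \<open>The tangent is taken at \<open>1 / N\<close>, the length of equal cells;
    summation then gives \<open>3 / N\<^sup>2 - 2 / N\<^sup>2 = 1 / N\<^sup>2\<close>.\<close>
  have cell: "cell_defect k (t (Suc j) - t j) \<ge> c * (3 * (1 / real N)\<^sup>2 * (t (Suc j) - t j) - 2 * (1 / real N) ^ 3)"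
    if "j < N" for j
  proof -
    define L where "L = t (Suc j) - t j"
    have L: "0 \<le> L" "L \<le> 1 / real m" using mono[of j "Suc j"] gap that by (auto simp: L_def)
    have "c * (3 * (1 / real N)\<^sup>2 * L - 2 * (1 / real N) ^ 3) \<le> c * L ^ 3"
      using pos L by (intro mult_left_mono cube_ge_tangent) (auto simp: c_def)
    also have "\<dots> = L ^ 3 / 12 - (2 * pi * k)\<^sup>2 * (L ^ 3 * (1 / real m)\<^sup>2) / 360"
      by (simp add: c_def field_simps)
    also have "\<dots> \<le> L ^ 3 / 12 - (2 * pi * k)\<^sup>2 * (L ^ 3 * L\<^sup>2) / 360"
      using L by (intro diff_left_mono divide_right_mono mult_left_mono power_mono) auto
    also have "\<dots> = L ^ 3 / 12 - (2 * pi * k)\<^sup>2 * L ^ 5 / 360"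
      by (simp flip: power_add)
    also have "\<dots> \<le> cell_defect k L" using cell_defect_ge_cubic[OF assms(1) L(1)] .
    finally show ?thesis by (simp add: L_def)
  qed
  have "c / (real (n + m))\<^sup>2 \<le> c / (real N)\<^sup>2"
    using pos \<open>N > 0\<close> \<open>N \<le> n + m\<close> by (intro divide_left_mono power_mono) (auto simp: c_def)
  also have "\<dots> = c * (3 * (1 / real N)\<^sup>2 * (\<Sum>j<N. t (Suc j) - t j) - real N * (2 * (1 / real N) ^ 3))"
    using t \<open>N > 0\<close> unfolding sum_increments by (simp add: field_simps power2_eq_square power3_eq_cube)
  also have "\<dots> = (\<Sum>j<N. c * (3 * (1 / real N)\<^sup>2 * (t (Suc j) - t j) - 2 * (1 / real N) ^ 3))"
    by (simp add: sum_subtractf sum_distrib_left right_diff_distrib)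
  also have "\<dots> \<le> (\<Sum>j<N. cell_defect k (t (Suc j) - t j))"
    by (intro sum_mono cell) simp
  finally have "sqrt (c / (real (n + m))\<^sup>2) \<le> sqrt (\<Sum>j<N. cell_defect k (t (Suc j) - t j))"
    by simp
  then show "sqrt (1 / 12 - (2 * pi * k)\<^sup>2 / (360 * (real m)\<^sup>2)) / real (n + m)
      \<le> sqrt (\<Sum>j<N. cell_defect k (t (Suc j) - t j))"
    by (simp add: c_def real_sqrt_divide)
qed

section \<open>Passage to the limits\<close>

lemma tendsto_high_frequency:
  fixes e :: "real \<Rightarrow> ennreal"
  assumes lower: "\<And>k. k \<noteq> 0 \<Longrightarrow> ennreal (sqrt (1 - c / \<bar>2 * pi * k\<bar>) / \<bar>2 * pi * k\<bar>) \<le> e k"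
    and upper: "\<And>k. k \<noteq> 0 \<Longrightarrow> e k \<le> ennreal (1 / \<bar>2 * pi * k\<bar>)"
  shows "((\<lambda>k. e k * ennreal \<bar>k\<bar>) \<longlongrightarrow> ennreal (1 / (2 * pi))) at_infinity"
proof (rule tendsto_sandwich[OF _ _ _ tendsto_const])
  have ne: "eventually (\<lambda>k::real. k \<noteq> 0) at_infinity"
    using eventually_not_equal_at_infinity by blast
  show "eventually (\<lambda>k. ennreal (sqrt (1 - c / (2 * pi) * inverse \<bar>k\<bar>) / (2 * pi)) \<le> e k * ennreal \<bar>k\<bar>) at_infinity"
    using ne
  proof eventually_elim
    case (elim k)
    have "ennreal (sqrt (1 - c / (2 * pi) * inverse \<bar>k\<bar>) / (2 * pi))
        = ennreal (sqrt (1 - c / \<bar>2 * pi * k\<bar>) / \<bar>2 * pi * k\<bar>) * ennreal \<bar>k\<bar>"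
      using elim by (subst ennreal_mult''[symmetric]) (auto simp: abs_mult field_simps)
    also have "\<dots> \<le> e k * ennreal \<bar>k\<bar>"
      by (intro mult_right_mono lower elim) simp
    finally show ?case .
  qed
  show "eventually (\<lambda>k. e k * ennreal \<bar>k\<bar> \<le> ennreal (1 / (2 * pi))) at_infinity"
    using ne
  proof eventually_elim
    case (elim k)
    have "e k * ennreal \<bar>k\<bar> \<le> ennreal (1 / \<bar>2 * pi * k\<bar>) * ennreal \<bar>k\<bar>"
      by (intro mult_right_mono upper elim) simp
    also have "\<dots> = ennreal (1 / (2 * pi))"
      using elim by (subst ennreal_mult''[symmetric]) (auto simp: abs_mult)
    finally show ?case .
  qed
  have "((\<lambda>k::real. inverse \<bar>k\<bar>) \<longlongrightarrow> 0) at_infinity"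
    using tendsto_inverse_0_at_top[OF filterlim_norm_at_top[where ?'a = real]] by simp
  then have "((\<lambda>k. sqrt (1 - c / (2 * pi) * inverse \<bar>k\<bar>) / (2 * pi)) \<longlongrightarrow> sqrt (1 - c / (2 * pi) * 0) / (2 * pi)) at_infinity"
    by (intro tendsto_intros) auto
  then show "((\<lambda>k. ennreal (sqrt (1 - c / (2 * pi) * inverse \<bar>k\<bar>) / (2 * pi))) \<longlongrightarrow> ennreal (1 / (2 * pi))) at_infinity"
    by (intro tendsto_ennrealI) simp
qed

text \<open>The grid size \<open>m\<close> must tend to infinity to remove the correction
  \<open>c / m\<^sup>2\<close>, yet be of smaller order than \<open>n\<close> to keep the
  denominator close to \<open>n\<close>; a size of about \<open>sqrt n\<close> does both.\<close>

lemma tendsto_many_nodes: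
  fixes e :: "nat \<Rightarrow> ennreal"
  assumes lower: "\<And>n m. \<lbrakk>m > 0; 1 / 12 - c / (360 * (real m)\<^sup>2) \<ge> 0\<rbrakk>
      \<Longrightarrow> ennreal (sqrt (1 / 12 - c / (360 * (real m)\<^sup>2)) / real (n + m)) \<le> e n"
    and upper: "\<And>n. n \<ge> 2 \<Longrightarrow> e n \<le> ennreal (1 / (2 * sqrt 3) / (real n - 1))"
    and "c \<ge> 0"
  shows "(\<lambda>n. e n * of_nat n) \<longlonglongrightarrow> ennreal (1 / (2 * sqrt 3))"
proof (rule tendsto_sandwich)
  have inv0: "(\<lambda>n. 1 / real n) \<longlonglongrightarrow> 0" by (rule lim_1_over_n)
  have "(\<lambda>n. 1 / 12 - c / 360 * (1 / real n)) \<longlonglongrightarrow> 1 / 12 - c / 360 * 0"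
    by (intro tendsto_intros inv0)
  then have "eventually (\<lambda>n. 1 / 12 - c / 360 * (1 / real n) > 0) sequentially"
    by (rule order_tendstoD) simp
  then show "eventually (\<lambda>n. ennreal (sqrt (1 / 12 - c / 360 * (1 / real n)) / (1 + sqrt (1 / real n) + 1 / real n))
      \<le> e n * of_nat n) sequentially"
    using eventually_gt_at_top[of 0]
  proof eventually_elim
    case (elim n)
    define m where "m = nat \<lceil>sqrt (real n)\<rceil>"
    have "real m = of_int \<lceil>sqrt (real n)\<rceil>" by (simp add: m_def)
    then have m: "sqrt (real n) \<le> real m" "real m \<le> sqrt (real n) + 1" by linarith+
    have "m > 0" using m(1) elim by (metis gr0I not_less of_nat_0 of_nat_0_less_iff real_sqrt_gt_0_iff)
    have "real n \<le> (real m)\<^sup>2" using power_mono[OF m(1), of 2] by simp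
    then have "c / (360 * (real m)\<^sup>2) \<le> c / (360 * real n)"
      using elim \<open>c \<ge> 0\<close> \<open>m > 0\<close> by (intro divide_left_mono) auto
    then have cm: "1 / 12 - c / 360 * (1 / real n) \<le> 1 / 12 - c / (360 * (real m)\<^sup>2)" by simp
    have pos: "0 \<le> 1 / 12 - c / (360 * (real m)\<^sup>2)" using cm elim(1) by linarith
    then have nonneg: "0 \<le> sqrt (1 / 12 - c / (360 * (real m)\<^sup>2)) * real n"
      by (intro mult_nonneg_nonneg real_sqrt_ge_zero) auto
    have "real n * sqrt (1 / real n) = sqrt (real n)"
      by (simp add: real_sqrt_divide real_div_sqrt)
    then have den: "real (n + m) \<le> real n * (1 + sqrt (1 / real n) + 1 / real n)"
      using m elim by (simp add: distrib_left)
    have "sqrt (1 / 12 - c / 360 * (1 / real n)) / (1 + sqrt (1 / real n) + 1 / real n)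
        = sqrt (1 / 12 - c / 360 * (1 / real n)) * real n / (real n * (1 + sqrt (1 / real n) + 1 / real n))"
      using elim by simp
    also have "\<dots> \<le> sqrt (1 / 12 - c / (360 * (real m)\<^sup>2)) * real n / real (n + m)"
      using cm den elim nonneg \<open>m > 0\<close> by (intro frac_le mult_right_mono real_sqrt_le_mono) auto
    finally have "ennreal (sqrt (1 / 12 - c / 360 * (1 / real n)) / (1 + sqrt (1 / real n) + 1 / real n))
        \<le> ennreal (sqrt (1 / 12 - c / (360 * (real m)\<^sup>2)) / real (n + m) * real n)"
      by (intro ennreal_leI) (simp add: field_simps)
    also have "\<dots> = ennreal (sqrt (1 / 12 - c / (360 * (real m)\<^sup>2)) / real (n + m)) * of_nat n"
      unfolding ennreal_of_nat_eq_real_of_nat by (rule ennreal_mult'') simp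
    also have "\<dots> \<le> e n * of_nat n"
      by (intro mult_right_mono lower \<open>m > 0\<close> pos) simp
    finally show ?case .
  qed
  have "(\<lambda>n. sqrt (1 / 12 - c / 360 * (1 / real n)) / (1 + sqrt (1 / real n) + 1 / real n))
      \<longlonglongrightarrow> sqrt (1 / 12 - c / 360 * 0) / (1 + sqrt 0 + 0)"
    by (intro tendsto_intros inv0) auto
  moreover have "sqrt (1 / 12) = 1 / (2 * sqrt 3)"
    by (rule real_sqrt_unique) (auto simp: power_mult_distrib power_divide)
  ultimately show "(\<lambda>n. ennreal (sqrt (1 / 12 - c / 360 * (1 / real n)) / (1 + sqrt (1 / real n) + 1 / real n)))
      \<longlonglongrightarrow> ennreal (1 / (2 * sqrt 3))"
    by (intro tendsto_ennrealI) simp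
  show "eventually (\<lambda>n. e n * of_nat n \<le> ennreal (1 / (2 * sqrt 3) * inverse (1 - 1 / real n))) sequentially"
    using eventually_ge_at_top[of 2]
  proof eventually_elim
    case (elim n)
    have "e n * of_nat n \<le> ennreal (1 / (2 * sqrt 3) / (real n - 1)) * of_nat n"
      by (intro mult_right_mono upper elim) simp
    also have "\<dots> = ennreal (1 / (2 * sqrt 3) / (real n - 1) * real n)"
      unfolding ennreal_of_nat_eq_real_of_nat by (rule ennreal_mult''[symmetric]) simp
    also have "1 / (2 * sqrt 3) / (real n - 1) * real n = 1 / (2 * sqrt 3) * inverse (1 - 1 / real n)"
      using elim by (simp add: field_simps)
    finally show ?case .
  qed
  have "(\<lambda>n. 1 / (2 * sqrt 3) * inverse (1 - 1 / real n)) \<longlonglongrightarrow> 1 / (2 * sqrt 3) * inverse (1 - 0)"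
    by (intro tendsto_intros inv0) auto
  then show "(\<lambda>n. ennreal (1 / (2 * sqrt 3) * inverse (1 - 1 / real n))) \<longlonglongrightarrow> ennreal (1 / (2 * sqrt 3))"
    by (intro tendsto_ennrealI) simp
qed

text \<open>Lower bounds pass from \<open>H1_0\<close> to the larger space \<open>H1\<close>, and
  the many-node upper bound passes back. For \<open>H1\<close> two nodes are needed to fix both
  boundary values: with one node the squared error is about \<open>2 / w\<^sup>2\<close>, and the
  limit would be \<open>sqrt 2 / (2 * pi)\<close>.\<close>

theorem mainTheorem7:
  shows "(\<forall>n::nat. n \<ge> 2 \<longrightarrow>
            ((\<lambda>k::real. minimal_error n (I_rho k) H1 * ennreal \<bar>k\<bar>)
               \<longlongrightarrow> ennreal (1 / (2 * pi))) at_infinity) \<and>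
         (\<forall>k::real. k \<noteq> 0 \<longrightarrow>
            (\<lambda>n::nat. minimal_error n (I_rho k) H1 * of_nat n)
               \<longlonglongrightarrow> ennreal (1 / (2 * sqrt 3))) \<and>
         (\<forall>n::nat.
            ((\<lambda>k::real. minimal_error n (I_rho k) H1_0 * ennreal \<bar>k\<bar>)
               \<longlongrightarrow> ennreal (1 / (2 * pi))) at_infinity) \<and>
         (\<forall>k::real. k \<noteq> 0 \<longrightarrow>
            (\<lambda>n::nat. minimal_error n (I_rho k) H1_0 * of_nat n)
               \<longlonglongrightarrow> ennreal (1 / (2 * sqrt 3)))"
proof -
  have sub: "minimal_error n J H1_0 \<le> minimal_error n J H1" for n J
    by (rule minimal_error_antimono_space) (auto simp: H1_0_def)
  show ?thesis
  proof (intro conjI allI impI)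
    fix n :: nat
    show "((\<lambda>k. minimal_error n (I_rho k) H1_0 * ennreal \<bar>k\<bar>) \<longlongrightarrow> ennreal (1 / (2 * pi))) at_infinity"
      by (rule tendsto_high_frequency[OF minimal_error_H1_0_ge_high_frequency minimal_error_H1_0_le_high_frequency])
    assume "n \<ge> 2"
    show "((\<lambda>k. minimal_error n (I_rho k) H1 * ennreal \<bar>k\<bar>) \<longlongrightarrow> ennreal (1 / (2 * pi))) at_infinity"
      by (rule tendsto_high_frequency[OF order_trans[OF minimal_error_H1_0_ge_high_frequency sub]
            minimal_error_H1_le_high_frequency[OF _ \<open>n \<ge> 2\<close>]])
  next
    fix k :: real assume k: "k \<noteq> 0"
    show "(\<lambda>n. minimal_error n (I_rho k) H1_0 * of_nat n) \<longlonglongrightarrow> ennreal (1 / (2 * sqrt 3))"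
      by (rule tendsto_many_nodes[OF minimal_error_H1_0_ge_many_nodes[OF k]
            order_trans[OF sub minimal_error_H1_le_many_nodes[OF k]] zero_le_power2])
    show "(\<lambda>n. minimal_error n (I_rho k) H1 * of_nat n) \<longlonglongrightarrow> ennreal (1 / (2 * sqrt 3))"
      by (rule tendsto_many_nodes[OF order_trans[OF minimal_error_H1_0_ge_many_nodes[OF k] sub]
            minimal_error_H1_le_many_nodes[OF k] zero_le_power2])
  qed
qed

end
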